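(* Let $(K,w)$ be an oriented weighted simplicial complex, let $0\le i\le \dim K$, and suppose that the Hodge Laplacian $\mathcal{L}_i$ is bounded on $\ell^2_w=\ell^2(S_i(K),w)$. Let $\rho$ be an intrinsic metric on $S_i(K)$ with jump size $s\in(0,\infty)$, and let $\lambda$ be the bottom of the $\ell^2$-spectrum of $\mathcal{L}_i$. For $t>0$, $r\ge 0$ put $$\zeta_s(t,r)=\frac{1}{s^2}\left(rs\,\operatorname{arcsinh}\frac{rs}{t}-\sqrt{t^2+r^2s^2}+t\right).$$ Let $A,B\subset S_i(K)$ and let $f,g\in\ell^2_w$ with $\operatorname{supp} f\subset A$ and $\operatorname{supp} g\subset B$. Then for all $t>0$ $$|\langle e^{-t\mathcal{L}_i}f,g\rangle|\le e^{-\lambda t-\zeta_s(t,\rho(A,B))}\,\|f\|_{\ell^2_w}\|g\|_{\ell^2_w}.$$ In particular, if $w(A),w(B)<\infty$, then for all $t>0$ $$\Big|\sum_{F'\in B}\sum_{F\in A}p_t(F,F')\,w(F)\,w(F')\Big|\le\sqrt{w(A)w(B)}\;e^{-\lambda t-\zeta_s(t,\rho(A,B))},$$ where $p_t(F,F')$ is the heat kernel of $\mathcal{L}_i$.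
   Context: Simplicial complexes. An abstract simplicial complex $K$ on a vertex set $V$ (possibly infinite) is a collection of finite subsets of $V$ closed under inclusion. An $i$-face is an element of $K$ of cardinality $i+1$; $S_i(K)$ is the set of $i$-faces, and $S_{-1}(K)=\{\emptyset\}$. $\dim K$ is the largest dimension of a face. $K$ is weighted by a function $w:\bigcup_{i=-1}^{\dim K}S_i(K)\to(0,\infty)$; for a set $A$ of faces, $w(A)=\sum_{F\in A}w(F)$. $K$ is oriented: every face has a chosen orientation (ordering of its vertices up to even permutations). For an $i$-face $F$, $\partial F$ denotes the set of its $(i-1)$-faces. For $F\in\partial\overline F$, $\sigma_{F\overline F}=\pm1$ is the sign of the oriented face $[F]$ in the boundary $\partial[v_0,\dots,v_{i+1}]=\sum_k(-1)^k[v_0,\dots,\widehat{v_k},\dots,v_{i+1}]$ of $[\overline F]$; $\sigma_{F\overline F}=0$ if $F\notin\partial\overline F$. Hodge Laplacian. Real $i$-cochains are identified with functions $f:S_i(K)\to\mathbb{R}$ via the chosen orientations. The inner product is $\langle f,g\rangle=\sum_{F\in S_i(K)}f(F)g(F)w(F)$, and $\ell^2_w=\ell^2(S_i(K),w)$ is the corresponding Hilbert space. The coboundary operator is $(\delta_if)(\overline F)=\sum_{F\in\partial\overline F}\sigma_{F\overline F}f(F)$, $\delta_i^*$ is its adjoint, and $\mathcal{L}_i=\delta_i^*\delta_i+\delta_{i-1}\delta_{i-1}^*$. "$\mathcal{L}_i$ is bounded" means that $\delta_i$ and $\delta_{i-1}$ are bounded operators between the corresponding $\ell^2_w$ spaces,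 so $\mathcal{L}_i$ is a bounded non-negative self-adjoint operator on $\ell^2_w$ and $e^{-t\mathcal{L}_i}$, $t\ge0$, is defined. The heat kernel is $p_t(F,F')=\big(e^{-t\mathcal{L}_i}\tfrac{1}{w(F')}\delta_{F'}\big)(F)$, where $\delta_{F'}$ is the function equal to $1$ at $F'$ and $0$ elsewhere. Intrinsic metrics. For distinct $i$-faces $F,F'$ set $w^{up}_{FF'}=w(\overline F)$ if there is an $(i+1)$-face $\overline F\in K$ with $F,F'\in\partial\overline F$ (then $\overline F=F\cup F'$ is unique) and $0$ otherwise; $w^{down}_{FF'}=\frac{w(F)w(F')}{w(E)}$ if $E=F\cap F'$ is an $(i-1)$-face and $0$ otherwise; $w_{FF'}=w^{up}_{FF'}+w^{down}_{FF'}$; and $w_{FF}=0$. Write $F\sim F'$ if $w_{FF'}\ne0$. A pseudo metric $\rho$ on $S_i(K)$ (the value $\infty$ is allowed) is intrinsic if $\sum_{F'\in S_i(K)}w_{FF'}\rho^2(F,F')\le w(F)$ for all $F\in S_i(K)$. Its jump size is $s=\sup\{\rho(F,F'):F,F'\in S_i(K),\ F\sim F'\}$ (with $s=\infty$ if there is no pair $F\sim F'$). For $A,B\subset S_i(K)$, $\rho(A,B)=\inf_{F\in A,F'\in B}\rho(F,F')$. If $\rho(A,B)=\infty$, then $\zeta_s(t,\infty)=\infty$ and $e^{-\infty}=0$. $\operatorname{supp} f=\{F\in S_i(K):f(F)\ne0\}$. *)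

theory Defs
  imports "HOL-Analysis.Analysis"
begin

section \<open>Weighted \<open>\<ell>\<^sup>2\<close> spaces and bounded operators between them\<close>

text \<open>
  The index sets are subsets of a type, so a function on \<^term>\<open>X :: 'a set\<close> is represented by its
  extension by zero to the whole type. With this convention \<open>l2 X w\<close> is exactly the Hilbert
  space \<open>\<ell>\<^sup>2(X, w)\<close>, and equality of its elements is equality of functions.
\<close>

definition l2 :: "'a set \<Rightarrow> ('a \<Rightarrow> real) \<Rightarrow> ('a \<Rightarrow> real) set" where
  "l2 X w = {f. (\<forall>x. x \<notin> X \<longrightarrow> f x = 0) \<and> (\<lambda>x. (f x)\<^sup>2 * w x) summable_on X}"

definition l2_inner :: "'a set \<Rightarrow> ('a \<Rightarrow> real) \<Rightarrow> ('a \<Rightarrow> real) \<Rightarrow> ('a \<Rightarrow> real) \<Rightarrow> real" where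
  "l2_inner X w f g = (\<Sum>\<^sub>\<infinity>x\<in>X. f x * g x * w x)"

definition l2_norm :: "'a set \<Rightarrow> ('a \<Rightarrow> real) \<Rightarrow> ('a \<Rightarrow> real) \<Rightarrow> real" where
  "l2_norm X w f = sqrt (l2_inner X w f f)"

definition l2_bounded_op ::
  "'a set \<Rightarrow> ('a \<Rightarrow> real) \<Rightarrow> 'b set \<Rightarrow> ('b \<Rightarrow> real) \<Rightarrow> (('a \<Rightarrow> real) \<Rightarrow> ('b \<Rightarrow> real)) \<Rightarrow> bool" where
  "l2_bounded_op X w Y v T \<longleftrightarrow>
     (\<forall>f\<in>l2 X w. T f \<in> l2 Y v) \<and>
     (\<forall>f\<in>l2 X w. \<forall>g\<in>l2 X w. T (\<lambda>x. f x + g x) = (\<lambda>y. T f y + T g y)) \<and>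
     (\<forall>c. \<forall>f\<in>l2 X w. T (\<lambda>x. c * f x) = (\<lambda>y. c * T f y)) \<and>
     (\<exists>C. \<forall>f\<in>l2 X w. l2_norm Y v (T f) \<le> C * l2_norm X w f)"

definition l2_adjoint ::
  "'a set \<Rightarrow> ('a \<Rightarrow> real) \<Rightarrow> 'b set \<Rightarrow> ('b \<Rightarrow> real) \<Rightarrow> (('a \<Rightarrow> real) \<Rightarrow> ('b \<Rightarrow> real))
    \<Rightarrow> (('b \<Rightarrow> real) \<Rightarrow> ('a \<Rightarrow> real))" where
  "l2_adjoint X w Y v T g =
     (THE h. h \<in> l2 X w \<and> (\<forall>f\<in>l2 X w. l2_inner Y v (T f) g = l2_inner X w f h))"

text \<open>
  Real spectrum. It is used only for self-adjoint operators, whose spectrum is real and agrees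
  with that of the complexification.
\<close>

definition l2_resolvent_set ::
  "'a set \<Rightarrow> ('a \<Rightarrow> real) \<Rightarrow> (('a \<Rightarrow> real) \<Rightarrow> ('a \<Rightarrow> real)) \<Rightarrow> real set" where
  "l2_resolvent_set X w T =
     {\<mu>. \<exists>R. l2_bounded_op X w X w R \<and>
        (\<forall>f\<in>l2 X w. R (\<lambda>x. T f x - \<mu> * f x) = f \<and> (\<lambda>x. T (R f) x - \<mu> * R f x) = f)}"

definition l2_spectrum ::
  "'a set \<Rightarrow> ('a \<Rightarrow> real) \<Rightarrow> (('a \<Rightarrow> real) \<Rightarrow> ('a \<Rightarrow> real)) \<Rightarrow> real set" where
  "l2_spectrum X w T = - l2_resolvent_set X w T"

definition l2_spectrum_bottom ::
  "'a set \<Rightarrow> ('a \<Rightarrow> real) \<Rightarrow> (('a \<Rightarrow> real) \<Rightarrow> ('a \<Rightarrow> real)) \<Rightarrow> real" where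
  "l2_spectrum_bottom X w T = Inf (l2_spectrum X w T)"

text \<open>The exponential series of a bounded operator, applied to \<open>f\<close>; the limit is taken in \<open>\<ell>\<^sup>2\<close>-norm.\<close>

definition l2_exp ::
  "'a set \<Rightarrow> ('a \<Rightarrow> real) \<Rightarrow> (('a \<Rightarrow> real) \<Rightarrow> ('a \<Rightarrow> real)) \<Rightarrow> (('a \<Rightarrow> real) \<Rightarrow> ('a \<Rightarrow> real))" where
  "l2_exp X w T f =
     (THE h. h \<in> l2 X w \<and>
        (\<lambda>N. l2_norm X w (\<lambda>x. (\<Sum>n<N. (T ^^ n) f x / fact n) - h x)) \<longlonglongrightarrow> 0)"


section \<open>Oriented weighted simplicial complexes\<close>

definition abstract_simplicial_complex :: "'v set \<Rightarrow> 'v set set \<Rightarrow> bool" where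
  "abstract_simplicial_complex V K \<longleftrightarrow>
     {} \<in> K \<and> (\<forall>F\<in>K. finite F \<and> F \<subseteq> V) \<and> (\<forall>F\<in>K. \<forall>E. E \<subseteq> F \<longrightarrow> E \<in> K)"

text \<open>Dimensions are integers, so that \<open>faces K (-1) = {{}}\<close>.\<close>

definition faces :: "'v set set \<Rightarrow> int \<Rightarrow> 'v set set" where
  "faces K i = {F \<in> K. int (card F) = i + 1}"

definition complex_dim :: "'v set set \<Rightarrow> ereal" where
  "complex_dim K = (SUP F\<in>K. ereal (real (card F) - 1))"

definition weighted_complex :: "'v set set \<Rightarrow> ('v set \<Rightarrow> real) \<Rightarrow> bool" where
  "weighted_complex K w \<longleftrightarrow> (\<forall>F\<in>K. 0 < w F)"

definition face_boundary :: "'v set \<Rightarrow> 'v set set" where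
  "face_boundary F = {E. E \<subseteq> F \<and> card E + 1 = card F}"

text \<open>
  An orientation of \<open>F\<close> is a class of orderings of its vertices modulo even permutations,
  orderings being distinct lists. A face with at most one vertex has a single orientation.
\<close>

definition ordering_class :: "'v list \<Rightarrow> 'v list set" where
  "ordering_class vs = {map p vs | p. p permutes set vs \<and> evenperm p}"

definition orientations :: "'v set \<Rightarrow> 'v list set set" where
  "orientations F = ordering_class ` {vs. distinct vs \<and> set vs = F}"

definition oriented_complex :: "'v set set \<Rightarrow> ('v set \<Rightarrow> 'v list set) \<Rightarrow> bool" where
  "oriented_complex K ori \<longleftrightarrow> (\<forall>F\<in>K. ori F \<in> orientations F)"

text \<open>
  The sign of \<open>[F]\<close> in \<open>\<partial>[v\<^sub>0, \<dots>, v\<^sub>i\<^sub>+\<^sub>1] = (\<Sum>k. (-1)^k [v\<^sub>0, \<dots>, v\<^sub>k omitted, \<dots>, v\<^sub>i\<^sub>+\<^sub>1])\<close>. The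
  value does not depend on the representative \<open>vs\<close> of the orientation of \<open>G\<close>. An ordering of
  \<open>F\<close> that is not in the chosen orientation represents \<open>-[F]\<close>.
\<close>

definition incidence_sign :: "('v set \<Rightarrow> 'v list set) \<Rightarrow> 'v set \<Rightarrow> 'v set \<Rightarrow> real" where
  "incidence_sign ori F G =
     (if F \<in> face_boundary G
      then let vs = (SOME vs. vs \<in> ori G);
               k = (THE k. k < length vs \<and> F = set vs - {vs ! k})
           in (-1) ^ k * (if take k vs @ drop (Suc k) vs \<in> ori F then 1 else - 1)
      else 0)"


section \<open>The Hodge Laplacian and its heat kernel\<close>

definition coboundary ::
  "'v set set \<Rightarrow> ('v set \<Rightarrow> 'v list set) \<Rightarrow> int \<Rightarrow> ('v set \<Rightarrow> real) \<Rightarrow> ('v set \<Rightarrow> real)" where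
  "coboundary K ori i f =
     (\<lambda>G. if G \<in> faces K (i + 1) then \<Sum>F\<in>face_boundary G. incidence_sign ori F G * f F else 0)"

definition coboundary_adjoint ::
  "'v set set \<Rightarrow> ('v set \<Rightarrow> real) \<Rightarrow> ('v set \<Rightarrow> 'v list set) \<Rightarrow> int
    \<Rightarrow> ('v set \<Rightarrow> real) \<Rightarrow> ('v set \<Rightarrow> real)" where
  "coboundary_adjoint K w ori i =
     l2_adjoint (faces K i) w (faces K (i + 1)) w (coboundary K ori i)"

definition hodge_laplacian ::
  "'v set set \<Rightarrow> ('v set \<Rightarrow> real) \<Rightarrow> ('v set \<Rightarrow> 'v list set) \<Rightarrow> int
    \<Rightarrow> ('v set \<Rightarrow> real) \<Rightarrow> ('v set \<Rightarrow> real)" where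
  "hodge_laplacian K w ori i f =
     (\<lambda>F. coboundary_adjoint K w ori i (coboundary K ori i f) F
        + coboundary K ori (i - 1) (coboundary_adjoint K w ori (i - 1) f) F)"

definition hodge_laplacian_bounded ::
  "'v set set \<Rightarrow> ('v set \<Rightarrow> real) \<Rightarrow> ('v set \<Rightarrow> 'v list set) \<Rightarrow> int \<Rightarrow> bool" where
  "hodge_laplacian_bounded K w ori i \<longleftrightarrow>
     l2_bounded_op (faces K i) w (faces K (i + 1)) w (coboundary K ori i) \<and>
     l2_bounded_op (faces K (i - 1)) w (faces K i) w (coboundary K ori (i - 1))"

definition heat_semigroup ::
  "'v set set \<Rightarrow> ('v set \<Rightarrow> real) \<Rightarrow> ('v set \<Rightarrow> 'v list set) \<Rightarrow> int \<Rightarrow> real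
    \<Rightarrow> ('v set \<Rightarrow> real) \<Rightarrow> ('v set \<Rightarrow> real)" where
  "heat_semigroup K w ori i t =
     l2_exp (faces K i) w (\<lambda>f F. - t * hodge_laplacian K w ori i f F)"

definition heat_kernel ::
  "'v set set \<Rightarrow> ('v set \<Rightarrow> real) \<Rightarrow> ('v set \<Rightarrow> 'v list set) \<Rightarrow> int \<Rightarrow> real
    \<Rightarrow> 'v set \<Rightarrow> 'v set \<Rightarrow> real" where
  "heat_kernel K w ori i t F F' =
     heat_semigroup K w ori i t (\<lambda>G. if G = F' then 1 / w F' else 0) F"


section \<open>Intrinsic metrics\<close>

definition w_up :: "'v set set \<Rightarrow> ('v set \<Rightarrow> real) \<Rightarrow> int \<Rightarrow> 'v set \<Rightarrow> 'v set \<Rightarrow> real" where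
  "w_up K w i F F' =
     (if \<exists>G\<in>faces K (i + 1). F \<in> face_boundary G \<and> F' \<in> face_boundary G
      then w (F \<union> F') else 0)"

definition w_down :: "'v set set \<Rightarrow> ('v set \<Rightarrow> real) \<Rightarrow> int \<Rightarrow> 'v set \<Rightarrow> 'v set \<Rightarrow> real" where
  "w_down K w i F F' =
     (if F \<inter> F' \<in> faces K (i - 1) then w F * w F' / w (F \<inter> F') else 0)"

definition face_weight :: "'v set set \<Rightarrow> ('v set \<Rightarrow> real) \<Rightarrow> int \<Rightarrow> 'v set \<Rightarrow> 'v set \<Rightarrow> real" where
  "face_weight K w i F F' = (if F = F' then 0 else w_up K w i F F' + w_down K w i F F')"

definition pseudo_metric_on :: "'a set \<Rightarrow> ('a \<Rightarrow> 'a \<Rightarrow> ennreal) \<Rightarrow> bool" where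
  "pseudo_metric_on X \<rho> \<longleftrightarrow>
     (\<forall>x\<in>X. \<rho> x x = 0) \<and> (\<forall>x\<in>X. \<forall>y\<in>X. \<rho> x y = \<rho> y x) \<and>
     (\<forall>x\<in>X. \<forall>y\<in>X. \<forall>z\<in>X. \<rho> x z \<le> \<rho> x y + \<rho> y z)"

text \<open>In \<^typ>\<open>ennreal\<close> we have \<open>0 * \<infinity> = 0\<close>, so only neighbours of \<open>F\<close> contribute to the sum.\<close>

definition intrinsic_metric ::
  "'v set set \<Rightarrow> ('v set \<Rightarrow> real) \<Rightarrow> int \<Rightarrow> ('v set \<Rightarrow> 'v set \<Rightarrow> ennreal) \<Rightarrow> bool" where
  "intrinsic_metric K w i \<rho> \<longleftrightarrow>
     pseudo_metric_on (faces K i) \<rho> \<and>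
     (\<forall>F\<in>faces K i.
        (\<Sum>\<^sub>\<infinity>F'\<in>faces K i. ennreal (face_weight K w i F F') * (\<rho> F F')\<^sup>2) \<le> ennreal (w F))"

definition jump_size ::
  "'v set set \<Rightarrow> ('v set \<Rightarrow> real) \<Rightarrow> int \<Rightarrow> ('v set \<Rightarrow> 'v set \<Rightarrow> ennreal) \<Rightarrow> ennreal" where
  "jump_size K w i \<rho> =
     (let N = {(F, F'). F \<in> faces K i \<and> F' \<in> faces K i \<and> face_weight K w i F F' \<noteq> 0}
      in if N = {} then \<infinity> else SUP (F, F')\<in>N. \<rho> F F')"

text \<open>The infimum over an empty index set is \<open>\<infinity>\<close>.\<close>

definition set_distance :: "('a \<Rightarrow> 'a \<Rightarrow> ennreal) \<Rightarrow> 'a set \<Rightarrow> 'a set \<Rightarrow> ennreal" where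
  "set_distance \<rho> A B = (INF x\<in>A. INF y\<in>B. \<rho> x y)"

definition zeta_fun :: "real \<Rightarrow> real \<Rightarrow> ennreal \<Rightarrow> ereal" where
  "zeta_fun s t r =
     (if r = \<infinity> then \<infinity>
      else let x = enn2real r
           in ereal (1 / s\<^sup>2 * (x * s * arsinh (x * s / t) - sqrt (t\<^sup>2 + x\<^sup>2 * s\<^sup>2) + t)))"

text \<open>Only used for exponents in \<open>[-\<infinity>, \<infinity>)\<close>; the value at \<open>\<infinity>\<close> is irrelevant.\<close>

definition exp_ereal :: "ereal \<Rightarrow> real" where
  "exp_ereal x = (if x = - \<infinity> then 0 else exp (real_of_ereal x))"

end

theory Submission
  imports Defs
begin

text \<open>
  Davies' method: for a bounded weight \<open>\<omega>\<close> vanishing on \<open>A\<close>, the conjugated operator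
  \<open>e\<^sup>\<omega> \<L>\<^sub>i e\<^sup>-\<^sup>\<omega>\<close> has the same quadratic form as \<open>\<L>\<^sub>i\<close>, except that its off-diagonal
  matrix entries are multiplied by \<open>cosh (\<omega> F - \<omega> F')\<close>. The entries of \<open>\<L>\<^sub>i\<close> between distinct
  faces are bounded by \<open>w\<^sub>F\<^sub>F\<^sub>'\<close>, whatever the signs. If \<open>\<omega>\<close> is \<open>\<alpha>\<close> times the truncated
  distance to \<open>A\<close>, then \<open>cosh x - 1 \<le> x\<^sup>2 (cosh (\<alpha> s) - 1) / (\<alpha> s)\<^sup>2\<close> for \<open>\<bar>x\<bar> \<le> \<alpha> s\<close> and the
  intrinsic metric condition bound the change of the form by \<open>\<kappa> = (cosh (\<alpha> s) - 1) / s\<^sup>2\<close>. So the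
  conjugated semigroup has norm at most \<open>e\<^sup>-\<^sup>(\<^sup>\<lambda>\<^sup>-\<^sup>\<kappa>\<^sup>)\<^sup>t\<close>, which gives the factor
  \<open>exp (- \<lambda> t + \<kappa> t - \<alpha> \<rho>(A, B))\<close>. The choice \<open>\<alpha> = arsinh (\<rho>(A, B) s / t) / s\<close> is optimal.
\<close>

section \<open>The Hilbert space of square summable functions\<close>

text \<open>The distance is truncated because \<open>exp \<omega>\<close> has to be a bounded
  operator. Truncating at a level M that is at most \<rho>(A, B) loses nothing, since the weight
  then equals \<alpha> M on all of B. If \<rho>(A, B) is infinite there is no optimal \<alpha>, and
  a limit M -> infinity takes its place. The conjugated operator is not symmetric, so its
  exponential is controlled through a bound on its quadratic form and not through its spectrum. For
  this reason the bottom of the spectrum is first turned into a lower bound for the form of the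
  Laplacian. The operator exponential is that of a Banach algebra. To have one,
  \<open>l2 X w\<close> is embedded isometrically in an unweighted space over the whole type, and
  operators are extended to that space. The kernel estimate is the case of two indicator functions.
  Symmetry of the semigroup evaluates the inner sum as a value of the semigroup applied to the
  indicator of A, so the order of the double sum is never interchanged.\<close>

lemma square_summable_mult:
  fixes f g :: "'a \<Rightarrow> real"
  assumes "(\<lambda>x. (f x)\<^sup>2) summable_on X" "(\<lambda>x. (g x)\<^sup>2) summable_on X"
  shows "(\<lambda>x. f x * g x) summable_on X"
proof -
  have "(\<lambda>x. (f x)\<^sup>2 + (g x)\<^sup>2) summable_on X"
    using assms by (rule summable_on_add)
  then have "(\<lambda>x. norm (f x * g x)) summable_on X"
  proof (rule summable_on_comparison_test)
    fix x
    have "0 \<le> (\<bar>f x\<bar> - \<bar>g x\<bar>)\<^sup>2" by simp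
    then have "2 * (\<bar>f x\<bar> * \<bar>g x\<bar>) \<le> (f x)\<^sup>2 + (g x)\<^sup>2"
      unfolding power2_diff by simp
    moreover have "0 \<le> \<bar>f x\<bar> * \<bar>g x\<bar>" by simp
    ultimately show "norm (f x * g x) \<le> (f x)\<^sup>2 + (g x)\<^sup>2"
      unfolding real_norm_def abs_mult by linarith
  qed simp
  then show ?thesis
    by (rule abs_summable_summable)
qed

lemma square_summable_add:
  fixes f g :: "'a \<Rightarrow> real"
  assumes "(\<lambda>x. (f x)\<^sup>2) summable_on X" "(\<lambda>x. (g x)\<^sup>2) summable_on X"
  shows "(\<lambda>x. (f x + g x)\<^sup>2) summable_on X"
  unfolding power2_sum mult.assoc
  by (intro summable_on_add summable_on_cmult_right square_summable_mult assms)

lemma square_summable_diff: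
  fixes f g :: "'a \<Rightarrow> real"
  assumes "(\<lambda>x. (f x)\<^sup>2) summable_on X" "(\<lambda>x. (g x)\<^sup>2) summable_on X"
  shows "(\<lambda>x. (f x - g x)\<^sup>2) summable_on X"
  using square_summable_add[of f X "\<lambda>x. - g x"] assms by simp

text \<open>Unweighted and over the whole type, so that it is an instance of \<open>banach\<close>
  and \<open>real_inner\<close> rather than a set of functions. The weighted spaces on subsets enter
  later as closed subspaces.\<close>

typedef 'a ell2 = "{f :: 'a \<Rightarrow> real. (\<lambda>x. (f x)\<^sup>2) summable_on UNIV}"
  by (rule exI[of _ "\<lambda>_. 0"]) simp

setup_lifting type_definition_ell2

instantiation ell2 :: (type) real_inner
begin

lift_definition zero_ell2 :: "'a ell2" is "\<lambda>_. 0" by simp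
lift_definition plus_ell2 :: "'a ell2 \<Rightarrow> 'a ell2 \<Rightarrow> 'a ell2" is "\<lambda>f g x. f x + g x"
  by (rule square_summable_add)
lift_definition minus_ell2 :: "'a ell2 \<Rightarrow> 'a ell2 \<Rightarrow> 'a ell2" is "\<lambda>f g x. f x - g x"
  by (rule square_summable_diff)
lift_definition uminus_ell2 :: "'a ell2 \<Rightarrow> 'a ell2" is "\<lambda>f x. - f x" by simp
lift_definition scaleR_ell2 :: "real \<Rightarrow> 'a ell2 \<Rightarrow> 'a ell2" is "\<lambda>c f x. c * f x"
  by (simp add: power_mult_distrib summable_on_cmult_right)
lift_definition inner_ell2 :: "'a ell2 \<Rightarrow> 'a ell2 \<Rightarrow> real" is "\<lambda>f g. \<Sum>\<^sub>\<infinity>x. f x * g x" .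

definition norm_ell2 :: "'a ell2 \<Rightarrow> real" where "norm_ell2 u = sqrt (inner u u)"
definition sgn_ell2 :: "'a ell2 \<Rightarrow> 'a ell2" where "sgn_ell2 u = inverse (norm u) *\<^sub>R u"
definition dist_ell2 :: "'a ell2 \<Rightarrow> 'a ell2 \<Rightarrow> real" where "dist_ell2 u v = norm (u - v)"
definition uniformity_ell2 :: "('a ell2 \<times> 'a ell2) filter" where
  "uniformity_ell2 = (INF e\<in>{0<..}. principal {(x, y). dist x y < e})"
definition open_ell2 :: "'a ell2 set \<Rightarrow> bool" where
  "open_ell2 U = (\<forall>x\<in>U. eventually (\<lambda>(x', y). x' = x \<longrightarrow> y \<in> U) uniformity)"

instance
proof
  fix x y z :: "'a ell2" and a b :: real
  show "x + y + z = x + (y + z)" by transfer auto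
  show "x + y = y + x" by transfer auto
  show "0 + x = x" by transfer auto
  show "- x + x = 0" by transfer auto
  show "x - y = x + - y" by transfer auto
  show "a *\<^sub>R (x + y) = a *\<^sub>R x + a *\<^sub>R y" by transfer (auto simp: algebra_simps)
  show "(a + b) *\<^sub>R x = a *\<^sub>R x + b *\<^sub>R x" by transfer (auto simp: algebra_simps)
  show "a *\<^sub>R b *\<^sub>R x = (a * b) *\<^sub>R x" by transfer auto
  show "1 *\<^sub>R x = x" by transfer auto
  show "dist x y = norm (x - y)" by (rule dist_ell2_def)
  show "sgn x = inverse (norm x) *\<^sub>R x" by (rule sgn_ell2_def)
  show "uniformity = (INF e\<in>{0<..}. principal {(x, y :: 'a ell2). dist x y < e})"
    by (rule uniformity_ell2_def)
  show "open U \<longleftrightarrow> (\<forall>x\<in>U. eventually (\<lambda>(x', y). x' = x \<longrightarrow> y \<in> U) uniformity)"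
    for U :: "'a ell2 set" by (rule open_ell2_def)
  show "inner x y = inner y x" by transfer (simp add: mult.commute)
  show "inner (x + y) z = inner x z + inner y z"
    by transfer (simp add: distrib_right infsum_add square_summable_mult)
  show "inner (a *\<^sub>R x) y = a * inner x y"
    by transfer (simp add: mult.assoc infsum_cmult_right')
  show "0 \<le> inner x x" by transfer (simp add: infsum_nonneg)
  show "inner x x = 0 \<longleftrightarrow> x = 0"
  proof transfer
    fix f :: "'a \<Rightarrow> real"
    assume f: "(\<lambda>x. (f x)\<^sup>2) summable_on UNIV"
    show "(\<Sum>\<^sub>\<infinity>x. f x * f x) = 0 \<longleftrightarrow> f = (\<lambda>_. 0)"
    proof
      assume "(\<Sum>\<^sub>\<infinity>x. f x * f x) = 0"
      with f have "f x * f x = 0" for x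
        by (intro nonneg_infsum_le_0D[of "\<lambda>x. f x * f x" UNIV x]) (auto simp: power2_eq_square)
      then show "f = (\<lambda>_. 0)" by auto
    qed simp
  qed
  show "norm x = sqrt (inner x x)" by (rule norm_ell2_def)
qed

end

lemma ell2_square_summable: "(\<lambda>x. (Rep_ell2 u x)\<^sup>2) summable_on UNIV"
  using Rep_ell2[of u] by simp

lemma norm_ell2_square: "(norm u)\<^sup>2 = (\<Sum>\<^sub>\<infinity>x. (Rep_ell2 u x)\<^sup>2)" for u :: "'a ell2"
  unfolding power2_norm_eq_inner inner_ell2.rep_eq by (simp add: power2_eq_square)

lemma ell2_finite_sum_le: "finite J \<Longrightarrow> (\<Sum>x\<in>J. (Rep_ell2 u x)\<^sup>2) \<le> (norm u)\<^sup>2"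
  unfolding norm_ell2_square by (intro finite_sum_le_infsum ell2_square_summable) auto

lemma abs_ell2_le_norm: "\<bar>Rep_ell2 u x\<bar> \<le> norm u"
  using ell2_finite_sum_le[of "{x}" u] abs_le_square_iff[of "Rep_ell2 u x" "norm u"] by simp

lemma norm_ell2_leI:
  assumes "0 \<le> c" "\<And>J. finite J \<Longrightarrow> (\<Sum>x\<in>J. (Rep_ell2 u x)\<^sup>2) \<le> c\<^sup>2"
  shows "norm u \<le> c"
proof -
  have "(norm u)\<^sup>2 \<le> c\<^sup>2"
    unfolding norm_ell2_square by (intro infsum_le_finite_sums ell2_square_summable assms)
  then show ?thesis using assms(1) by (rule power2_le_imp_le)
qed

lemma square_summableI:
  fixes f :: "'a \<Rightarrow> real"
  assumes "\<And>J. finite J \<Longrightarrow> J \<subseteq> X \<Longrightarrow> (\<Sum>x\<in>J. (f x)\<^sup>2) \<le> c"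
  shows "(\<lambda>x. (f x)\<^sup>2) summable_on X"
  by (rule nonneg_bdd_above_summable_on) (auto intro!: bdd_aboveI[of _ c] assms)

instance ell2 :: (type) banach
proof
  fix X :: "nat \<Rightarrow> 'a ell2"
  assume X: "Cauchy X"
  have "convergent (\<lambda>n. Rep_ell2 (X n) x)" for x
  proof (rule Cauchy_convergent, rule CauchyI)
    fix e :: real assume "0 < e"
    then obtain M where "\<forall>m\<ge>M. \<forall>n\<ge>M. norm (X m - X n) < e"
      using CauchyD[OF X] by blast
    then show "\<exists>M. \<forall>m\<ge>M. \<forall>n\<ge>M. norm (Rep_ell2 (X m) x - Rep_ell2 (X n) x) < e"
      using abs_ell2_le_norm[of "X _ - X _" x]
      by (metis minus_ell2.rep_eq order_le_less_trans real_norm_def)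
  qed
  then obtain l where l: "\<And>x. (\<lambda>n. Rep_ell2 (X n) x) \<longlonglongrightarrow> l x"
    unfolding convergent_def by metis
  \<comment> \<open>Fatou's argument: m tends to infinity inside a finite sum, and the resulting
    bound does not depend on J. It serves twice, for square summability of the limit and for
    convergence in norm.\<close>
  have bound: "(\<Sum>x\<in>J. (Rep_ell2 (X n) x - l x)\<^sup>2) \<le> e\<^sup>2"
    if "finite J" "\<forall>m\<ge>M. norm (X n - X m) < e" for J n M e
  proof (rule LIMSEQ_le_const2)
    show "(\<lambda>m. \<Sum>x\<in>J. (Rep_ell2 (X n) x - Rep_ell2 (X m) x)\<^sup>2)
        \<longlonglongrightarrow> (\<Sum>x\<in>J. (Rep_ell2 (X n) x - l x)\<^sup>2)"
      by (intro tendsto_intros l)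
    show "\<exists>N. \<forall>m\<ge>N. (\<Sum>x\<in>J. (Rep_ell2 (X n) x - Rep_ell2 (X m) x)\<^sup>2) \<le> e\<^sup>2"
    proof (intro exI allI impI)
      fix m assume "M \<le> m"
      then have "(norm (X n - X m))\<^sup>2 \<le> e\<^sup>2"
        using that(2) by (intro power_mono) (auto intro: less_imp_le)
      then show "(\<Sum>x\<in>J. (Rep_ell2 (X n) x - Rep_ell2 (X m) x)\<^sup>2) \<le> e\<^sup>2"
        using ell2_finite_sum_le[OF that(1), of "X n - X m"] by (simp add: minus_ell2.rep_eq)
    qed
  qed
  obtain M where M: "\<forall>m\<ge>M. \<forall>n\<ge>M. norm (X m - X n) < 1"
    using CauchyD[OF X] by (metis zero_less_one)
  have "(\<lambda>x. (Rep_ell2 (X M) x - l x)\<^sup>2) summable_on UNIV"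
    using bound[of _ M M 1] M by (intro square_summableI[where c = "1\<^sup>2"]) auto
  \<comment> \<open>\<open>l\<close> is recovered as \<open>X M - (X M - l)\<close>.\<close>
  from square_summable_diff[OF ell2_square_summable[of "X M"] this]
  have l_sum: "(\<lambda>x. (l x)\<^sup>2) summable_on UNIV" by simp
  define L where "L = Abs_ell2 l"
  have L: "Rep_ell2 L = l"
    unfolding L_def using l_sum by (simp add: Abs_ell2_inverse)
  have "X \<longlonglongrightarrow> L"
  proof (rule LIMSEQ_I)
    fix e :: real assume "0 < e"
    then obtain M where M: "\<forall>m\<ge>M. \<forall>n\<ge>M. norm (X m - X n) < e / 2"
      using CauchyD[OF X] by (meson half_gt_zero)
    have "norm (X n - L) < e" if "n \<ge> M" for n
    proof -
      have "norm (X n - L) \<le> e / 2"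
        using \<open>0 < e\<close> M that bound[of _ M n "e / 2"]
        by (intro norm_ell2_leI) (auto simp: minus_ell2.rep_eq L)
      then show ?thesis using \<open>0 < e\<close> by simp
    qed
    then show "\<exists>M. \<forall>n\<ge>M. norm (X n - L) < e" by blast
  qed
  then show "convergent X" by (rule convergentI)
qed

section \<open>Coordinates, Riesz representation and adjoints\<close>

lift_definition ell2_basis :: "'a \<Rightarrow> 'a ell2" is "\<lambda>x y. if x = y then 1 else (0 :: real)"
proof -
  fix a :: 'a
  show "(\<lambda>y. (if a = y then 1 else 0 :: real)\<^sup>2) summable_on UNIV"
    by (rule finite_nonzero_values_imp_summable_on) (auto intro: finite_subset[of _ "{a}"])
qed

lemma inner_ell2_basis: "inner (ell2_basis x) u = Rep_ell2 u x"
proof -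
  have "inner (ell2_basis x) u = (\<Sum>\<^sub>\<infinity>y\<in>{x}. Rep_ell2 (ell2_basis x) y * Rep_ell2 u y)"
    unfolding inner_ell2.rep_eq by (rule infsum_cong_neutral) (auto simp: ell2_basis.rep_eq)
  then show ?thesis by (simp add: ell2_basis.rep_eq)
qed

lemma norm_ell2_basis [simp]: "norm (ell2_basis x) = 1"
  by (simp add: norm_eq_sqrt_inner inner_ell2_basis ell2_basis.rep_eq)

text \<open>The unit of the operator algebra must have norm 1, which fails on the zero space;
  \<open>perfect_space\<close> is the class that excludes this.\<close>

instance ell2 :: (type) perfect_space
proof
  fix u :: "'a ell2"
  show "\<not> open {u}"
  proof
    assume "open {u}"
    then obtain e where e: "0 < e" "\<And>v. dist v u < e \<Longrightarrow> v = u"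
      by (auto simp: open_dist)
    from e(1) have "u + (e / 2) *\<^sub>R ell2_basis undefined = u"
      by (intro e(2)) (simp add: dist_norm)
    then have "norm ((e / 2) *\<^sub>R ell2_basis (undefined :: 'a)) = 0"
      by (simp only: add_cancel_left_right norm_zero)
    with e(1) show False by simp
  qed
qed

lemma Rep_ell2_sum: "Rep_ell2 (sum f J) x = (\<Sum>j\<in>J. Rep_ell2 (f j) x)"
  by (induction J rule: infinite_finite_induct) (auto simp: zero_ell2.rep_eq plus_ell2.rep_eq)

lemma Rep_ell2_finite_expansion:
  "finite J \<Longrightarrow> Rep_ell2 (\<Sum>x\<in>J. c x *\<^sub>R ell2_basis x) y = (if y \<in> J then c y else 0)"
  by (simp add: Rep_ell2_sum scaleR_ell2.rep_eq ell2_basis.rep_eq if_distrib[of "(*) _"] sum.delta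
      cong: if_cong)

text \<open>Parseval, in the form of \<open>norm_tail\<close>: the squared distance from u to its
  partial sum over J is the tail of the series for the squared norm.\<close>

lemma ell2_expansion: "((\<lambda>x. Rep_ell2 u x *\<^sub>R ell2_basis x) has_sum u) UNIV"
proof -
  have norm_tail: "(norm ((\<Sum>x\<in>J. Rep_ell2 u x *\<^sub>R ell2_basis x) - u))\<^sup>2
      = (norm u)\<^sup>2 - (\<Sum>x\<in>J. (Rep_ell2 u x)\<^sup>2)" if "finite J" for J
  proof -
    define v where "v = (\<Sum>x\<in>J. Rep_ell2 u x *\<^sub>R ell2_basis x)"
    have "inner v u = (\<Sum>x\<in>J. (Rep_ell2 u x)\<^sup>2)"
      by (simp add: v_def inner_sum_left inner_ell2_basis power2_eq_square)
    moreover have "inner v v = (\<Sum>x\<in>J. Rep_ell2 u x * Rep_ell2 v x)"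
      by (subst (1) v_def) (simp add: inner_sum_left inner_ell2_basis)
    then have "inner v v = (\<Sum>x\<in>J. (Rep_ell2 u x)\<^sup>2)"
      using that by (simp add: v_def Rep_ell2_finite_expansion power2_eq_square)
    ultimately show ?thesis
      unfolding v_def[symmetric]
      by (simp add: power2_norm_eq_inner inner_diff_left inner_diff_right inner_commute)
  qed
  have "((\<lambda>x. (Rep_ell2 u x)\<^sup>2) has_sum (norm u)\<^sup>2) UNIV"
    unfolding norm_ell2_square using ell2_square_summable by (rule has_sum_infsum)
  then have "((\<lambda>J. (norm u)\<^sup>2 - (\<Sum>x\<in>J. (Rep_ell2 u x)\<^sup>2)) \<longlongrightarrow> (norm u)\<^sup>2 - (norm u)\<^sup>2)
      (finite_subsets_at_top UNIV)"
    unfolding has_sum_def by (intro tendsto_intros)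
  then have "((\<lambda>J. sqrt ((norm u)\<^sup>2 - (\<Sum>x\<in>J. (Rep_ell2 u x)\<^sup>2))) \<longlongrightarrow> sqrt 0)
      (finite_subsets_at_top UNIV)"
    by (intro tendsto_real_sqrt) simp
  then have "((\<lambda>J. norm ((\<Sum>x\<in>J. Rep_ell2 u x *\<^sub>R ell2_basis x) - u)) \<longlongrightarrow> 0)
      (finite_subsets_at_top UNIV)"
    unfolding real_sqrt_zero
    by (rule Lim_transform_eventually)
      (auto intro!: eventually_finite_subsets_at_top_weakI simp flip: norm_tail)
  then show ?thesis
    unfolding has_sum_def by (simp add: tendsto_norm_zero_iff flip: LIM_zero_iff[of _ u])
qed

text \<open>The representing vector must have the coordinates \<phi>(e_x). They are square summable
  because \<phi>, tested on the truncated candidate v, takes the value \<open>S = inner v v\<close>,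
  whence S <= sqrt S * C.\<close>

lemma ell2_riesz:
  fixes \<phi> :: "'a ell2 \<Rightarrow> real"
  assumes "bounded_linear \<phi>"
  obtains h where "\<And>u. \<phi> u = inner u h"
proof -
  interpret bounded_linear \<phi> by fact
  obtain C where C: "0 \<le> C" "\<And>u. \<bar>\<phi> u\<bar> \<le> norm u * C"
    using nonneg_bounded by auto
  define a where "a x = \<phi> (ell2_basis x)" for x
  have "(\<Sum>x\<in>J. (a x)\<^sup>2) \<le> C\<^sup>2" if "finite J" for J
  proof -
    define v where "v = (\<Sum>x\<in>J. a x *\<^sub>R ell2_basis x)"
    define S where "S = (\<Sum>x\<in>J. (a x)\<^sup>2)"
    have "\<phi> v = S"
      by (simp add: v_def S_def sum scaleR a_def power2_eq_square)
    moreover have "inner v v = (\<Sum>x\<in>J. a x * Rep_ell2 v x)"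
      by (subst (1) v_def) (simp add: inner_sum_left inner_ell2_basis)
    then have "inner v v = S"
      using that by (simp add: v_def S_def Rep_ell2_finite_expansion power2_eq_square)
    moreover have "0 \<le> S" by (simp add: S_def sum_nonneg)
    ultimately have "S \<le> sqrt S * C"
      using C(2)[of v] by (simp add: norm_eq_sqrt_inner)
    then have "sqrt S * sqrt S \<le> sqrt S * C"
      using \<open>0 \<le> S\<close> by simp
    then have "sqrt S \<le> C"
      using \<open>0 \<le> S\<close> C(1) by (cases "S = 0") (auto simp del: real_sqrt_mult_self)
    then have "(sqrt S)\<^sup>2 \<le> C\<^sup>2"
      using \<open>0 \<le> S\<close> by (intro power_mono) auto
    then show ?thesis using \<open>0 \<le> S\<close> by (simp add: S_def)
  qed
  then have "(\<lambda>x. (a x)\<^sup>2) summable_on UNIV"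
    by (intro square_summableI) auto
  then have h: "Rep_ell2 (Abs_ell2 a) = a" by (simp add: Abs_ell2_inverse)
  have "\<phi> u = inner u (Abs_ell2 a)" for u
  proof -
    have "((\<lambda>x. \<phi> (Rep_ell2 u x *\<^sub>R ell2_basis x)) has_sum \<phi> u) UNIV"
      by (rule has_sum_bounded_linear[OF assms ell2_expansion])
    moreover have "((\<lambda>x. inner (Rep_ell2 u x *\<^sub>R ell2_basis x) (Abs_ell2 a))
        has_sum inner u (Abs_ell2 a)) UNIV"
      by (rule has_sum_bounded_linear[OF bounded_linear_inner_left ell2_expansion])
    ultimately show ?thesis
      by (simp add: scaleR inner_ell2_basis h flip: a_def) (rule has_sum_unique)
  qed
  then show ?thesis by (rule that)
qed

text \<open>Riesz gives T' v for each v; the norm bound comes from testing the defining identity at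
  u = T' v. This existence is what lets the description in \<open>l2_adjoint\<close> denote.\<close>

lemma ell2_adjoint_exists:
  fixes T :: "'a ell2 \<Rightarrow> 'b ell2"
  assumes "bounded_linear T"
  obtains T' where "bounded_linear T'" "\<And>u v. inner (T u) v = inner u (T' v)"
proof -
  interpret bounded_linear T by fact
  have "\<exists>h. \<forall>u. inner (T u) v = inner u h" for v
    using ell2_riesz[OF bounded_linear_compose[OF bounded_linear_inner_left[of v] assms]]
    by metis
  then obtain T' where T': "\<And>u v. inner (T u) v = inner u (T' v)" by metis
  obtain C where C: "0 \<le> C" "\<And>u. norm (T u) \<le> norm u * C"
    using nonneg_bounded by auto
  have "bounded_linear T'"
  proof (rule bounded_linear_intro[where K = C])
    fix v v' and c :: real
    show "T' (v + v') = T' v + T' v'"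
      unfolding vector_eq_ldot[symmetric, of "T' (v + v')"] by (simp add: inner_add_right flip: T')
    show "T' (c *\<^sub>R v) = c *\<^sub>R T' v"
      unfolding vector_eq_ldot[symmetric, of "T' (c *\<^sub>R v)"] by (simp flip: T')
    show "norm (T' v) \<le> norm v * C"
    proof -
      have "norm (T' v) * norm (T' v) = inner (T (T' v)) v"
        by (simp add: T' power2_norm_eq_inner flip: power2_eq_square)
      also have "\<dots> \<le> norm (T (T' v)) * norm v" by (rule norm_cauchy_schwarz)
      also have "\<dots> \<le> norm (T' v) * (norm v * C)"
        using mult_right_mono[OF C(2)[of "T' v"], of "norm v"] by (simp add: ac_simps)
      finally show ?thesis
        using C(1) by (cases "norm (T' v) = 0") (auto simp: mult_le_cancel_left simp del: norm_eq_zero)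
    qed
  qed
  with T' show ?thesis by (intro that)
qed

section \<open>The Banach algebra of bounded operators\<close>

text \<open>A copy of the bounded operators from a space to itself. Composition has to be the
  multiplication of a type class before \<open>exp\<close>, powers and Neumann series apply to
  operators.\<close>

typedef (overloaded) 'a endo = "UNIV :: ('a::real_normed_vector \<Rightarrow>\<^sub>L 'a) set" ..

setup_lifting type_definition_endo

lift_definition endo_apply :: "'a::real_normed_vector endo \<Rightarrow> 'a \<Rightarrow> 'a" is blinfun_apply .
lift_definition Endo :: "('a \<Rightarrow> 'a) \<Rightarrow> 'a::real_normed_vector endo" is Blinfun .

instantiation endo :: ("{real_normed_vector, perfect_space}") real_normed_algebra_1
begin

lift_definition zero_endo :: "'a endo" is 0 .
lift_definition one_endo :: "'a endo" is id_blinfun .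
lift_definition plus_endo :: "'a endo \<Rightarrow> 'a endo \<Rightarrow> 'a endo" is "(+)" .
lift_definition minus_endo :: "'a endo \<Rightarrow> 'a endo \<Rightarrow> 'a endo" is "(-)" .
lift_definition uminus_endo :: "'a endo \<Rightarrow> 'a endo" is "uminus" .
lift_definition scaleR_endo :: "real \<Rightarrow> 'a endo \<Rightarrow> 'a endo" is scaleR .
lift_definition times_endo :: "'a endo \<Rightarrow> 'a endo \<Rightarrow> 'a endo" is "(o\<^sub>L)" .
lift_definition norm_endo :: "'a endo \<Rightarrow> real" is norm .

definition sgn_endo :: "'a endo \<Rightarrow> 'a endo" where "sgn_endo u = inverse (norm u) *\<^sub>R u"
definition dist_endo :: "'a endo \<Rightarrow> 'a endo \<Rightarrow> real" where "dist_endo u v = norm (u - v)"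
definition uniformity_endo :: "('a endo \<times> 'a endo) filter" where
  "uniformity_endo = (INF e\<in>{0<..}. principal {(x, y). dist x y < e})"
definition open_endo :: "'a endo set \<Rightarrow> bool" where
  "open_endo U = (\<forall>x\<in>U. eventually (\<lambda>(x', y). x' = x \<longrightarrow> y \<in> U) uniformity)"

instance
proof
  fix x y z :: "'a endo" and a b :: real
  show "x + y + z = x + (y + z)" by transfer (rule add.assoc)
  show "x + y = y + x" by transfer (rule add.commute)
  show "0 + x = x" by transfer simp
  show "- x + x = 0" by transfer simp
  show "x - y = x + - y" by transfer simp
  show "a *\<^sub>R (x + y) = a *\<^sub>R x + a *\<^sub>R y" by transfer (rule scaleR_add_right)
  show "(a + b) *\<^sub>R x = a *\<^sub>R x + b *\<^sub>R x" by transfer (rule scaleR_add_left)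
  show "a *\<^sub>R b *\<^sub>R x = (a * b) *\<^sub>R x" by transfer simp
  show "1 *\<^sub>R x = x" by transfer simp
  show "x * y * z = x * (y * z)" by transfer (auto intro!: blinfun_eqI)
  show "(x + y) * z = x * z + y * z"
    by transfer (auto intro!: blinfun_eqI simp: blinfun.bilinear_simps)
  show "x * (y + z) = x * y + x * z"
    by transfer (auto intro!: blinfun_eqI simp: blinfun.bilinear_simps)
  show "a *\<^sub>R x * y = a *\<^sub>R (x * y)"
    by transfer (auto intro!: blinfun_eqI simp: blinfun.bilinear_simps)
  show "x * a *\<^sub>R y = a *\<^sub>R (x * y)"
    by transfer (auto intro!: blinfun_eqI simp: blinfun.bilinear_simps)
  show "1 * x = x" by transfer (auto intro!: blinfun_eqI)
  show "x * 1 = x" by transfer (auto intro!: blinfun_eqI)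
  show "(0 :: 'a endo) \<noteq> 1"
  proof transfer
    have "norm (0 :: 'a \<Rightarrow>\<^sub>L 'a) \<noteq> norm (id_blinfun :: 'a \<Rightarrow>\<^sub>L 'a)" by simp
    then show "0 \<noteq> (id_blinfun :: 'a \<Rightarrow>\<^sub>L 'a)" by metis
  qed
  show "dist x y = norm (x - y)" by (rule dist_endo_def)
  show "sgn x = inverse (norm x) *\<^sub>R x" by (rule sgn_endo_def)
  show "uniformity = (INF e\<in>{0<..}. principal {(x, y :: 'a endo). dist x y < e})"
    by (rule uniformity_endo_def)
  show "open U \<longleftrightarrow> (\<forall>x\<in>U. eventually (\<lambda>(x', y). x' = x \<longrightarrow> y \<in> U) uniformity)"
    for U :: "'a endo set" by (rule open_endo_def)
  show "norm x = 0 \<longleftrightarrow> x = 0" by transfer simp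
  show "norm (x + y) \<le> norm x + norm y" by transfer (rule norm_triangle_ineq)
  show "norm (a *\<^sub>R x) = \<bar>a\<bar> * norm x" by transfer simp
  show "norm (x * y) \<le> norm x * norm y" by transfer (rule norm_blinfun_compose)
  show "norm (1 :: 'a endo) = 1" by transfer simp
qed

end

instance endo :: ("{banach, perfect_space}") banach
proof
  fix X :: "nat \<Rightarrow> 'a endo"
  assume X: "Cauchy X"
  have Rep_dist: "dist (Rep_endo A) (Rep_endo B) = dist A B" for A B :: "'a endo"
    by (simp add: dist_norm norm_endo.rep_eq minus_endo.rep_eq)
  from X have "Cauchy (\<lambda>n. Rep_endo (X n))"
    by (simp add: Cauchy_def Rep_dist)
  then obtain L where "(\<lambda>n. Rep_endo (X n)) \<longlonglongrightarrow> Rep_endo L"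
    using Cauchy_convergent convergent_def by (metis Abs_endo_inverse UNIV_I)
  then have "X \<longlonglongrightarrow> L"
    by (simp add: lim_sequentially Rep_dist)
  then show "convergent X" by (rule convergentI)
qed

lemma endo_apply_Endo: "bounded_linear T \<Longrightarrow> endo_apply (Endo T) = T"
  by transfer (rule bounded_linear_Blinfun_apply)

lemma bounded_bilinear_endo_apply:
  "bounded_bilinear (endo_apply :: 'a::{real_normed_vector, perfect_space} endo \<Rightarrow> 'a \<Rightarrow> 'a)"
proof
  fix A B :: "'a endo" and u v :: 'a and c :: real
  show "endo_apply (A + B) u = endo_apply A u + endo_apply B u"
    by transfer (rule blinfun.add_left)
  show "endo_apply A (u + v) = endo_apply A u + endo_apply A v"
    by transfer (rule blinfun.add_right)
  show "endo_apply (c *\<^sub>R A) u = c *\<^sub>R endo_apply A u"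
    by transfer (rule blinfun.scaleR_left)
  show "endo_apply A (c *\<^sub>R u) = c *\<^sub>R endo_apply A u"
    by transfer (rule blinfun.scaleR_right)
  have "norm (endo_apply A u) \<le> norm A * norm u * 1" for A :: "'a endo" and u
    unfolding mult_1_right by transfer (rule norm_blinfun)
  then show "\<exists>K. \<forall>A u. norm (endo_apply (A :: 'a endo) u) \<le> norm A * norm u * K"
    by blast
qed

interpretation endo: bounded_bilinear endo_apply
  by (rule bounded_bilinear_endo_apply)

lemma norm_endo_apply: "norm (endo_apply A u) \<le> norm A * norm u"
  by transfer (rule norm_blinfun)

lemma norm_endo_leI: "0 \<le> c \<Longrightarrow> (\<And>u. norm (endo_apply A u) \<le> c * norm u) \<Longrightarrow> norm A \<le> c"
  by transfer (rule norm_blinfun_bound)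

lemma endo_apply_times [simp]: "endo_apply (A * B) u = endo_apply A (endo_apply B u)"
  by transfer simp

lemma endo_apply_one [simp]: "endo_apply 1 u = u"
  by transfer simp

lemma endo_apply_power: "endo_apply (A ^ n) u = (endo_apply A ^^ n) u"
  by (induction n) auto

lemma endo_eqI: "(\<And>u. endo_apply A u = endo_apply B u) \<Longrightarrow> A = B"
  by transfer (rule blinfun_eqI)

text \<open>The bridge from the exponential of the algebra to the series applied to one vector,
  which is the form used in \<open>l2_exp\<close>.\<close>

lemma endo_exp_apply_sums:
  fixes A :: "'a::{banach, perfect_space} endo"
  shows "(\<lambda>n. (endo_apply A ^^ n) u /\<^sub>R fact n) sums endo_apply (exp A) u"
proof -
  have "(\<lambda>n. A ^ n /\<^sub>R fact n) sums exp A"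
    unfolding exp_def by (rule summable_sums[OF summable_exp_generic])
  from bounded_linear.sums[OF endo.bounded_linear_left this]
  show ?thesis by (simp add: endo.scaleR_left endo_apply_power)
qed

lemma endo_exp_symmetric:
  fixes A :: "'a::{real_inner, banach, perfect_space} endo"
  assumes "\<And>u v. inner (endo_apply A u) v = inner u (endo_apply A v)"
  shows "inner (endo_apply (exp A) u) v = inner u (endo_apply (exp A) v)"
proof -
  have pow: "inner ((endo_apply A ^^ n) u) v = inner u ((endo_apply A ^^ n) v)" for n u v
    by (induction n arbitrary: u v) (auto simp: assms simp flip: funpow_swap1)
  have "(\<lambda>n. inner ((endo_apply A ^^ n) u /\<^sub>R fact n) v) sums inner (endo_apply (exp A) u) v"
    by (rule bounded_linear.sums[OF bounded_linear_inner_left endo_exp_apply_sums])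
  moreover have "(\<lambda>n. inner u ((endo_apply A ^^ n) v /\<^sub>R fact n)) sums
      inner u (endo_apply (exp A) v)"
    by (rule bounded_linear.sums[OF bounded_linear_inner_right endo_exp_apply_sums])
  ultimately show ?thesis
    by (simp add: pow) (rule sums_unique2)
qed

text \<open>The powers telescope through \<open>E * D = 1\<close>. The intertwining form is the one
  applied later: D is moved past the exponential onto the vector, which it will fix.\<close>

lemma exp_conjugate:
  fixes A D E :: "'a::{real_normed_algebra_1, banach}"
  assumes "E * D = 1"
  shows "exp (D * A * E) * D = D * exp A"
proof -
  have "(D * A * E) ^ n * D = D * A ^ n" for n
  proof (induction n)
    case (Suc n)
    have "(D * A * E) ^ Suc n * D = D * A * E * ((D * A * E) ^ n * D)"
      by (simp only: power_Suc mult.assoc)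
    also have "\<dots> = D * A * (E * D) * A ^ n"
      by (simp only: Suc) (simp only: mult.assoc)
    finally show ?case by (simp add: assms mult.assoc)
  qed simp
  then show ?thesis
    by (simp add: exp_def suminf_mult[OF summable_exp_generic, symmetric]
        suminf_mult2[OF summable_exp_generic])
qed

text \<open>Adding a large multiple \<open>M\<close> of the identity makes the bound \<open>c\<close> on the numerical range
  visible in the operator norm, \<open>\<parallel>A + M\<parallel> \<le> M + c + O(1 / M)\<close>, and \<open>exp A = exp (- M) exp (A + M)\<close>.\<close>

lemma norm_endo_exp_le:
  fixes A :: "'a::{real_inner, banach, perfect_space} endo"
  assumes A: "\<And>u. inner (endo_apply A u) u \<le> c * (norm u)\<^sup>2"
  shows "norm (exp A) \<le> exp c"
proof -
  have bound: "norm (exp A) \<le> exp (c + d)" if "0 < d" for d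
  proof -
    define C where "C = (norm A)\<^sup>2"
    \<comment> \<open>C / (2 d) lets the cross term 2 (M + c) d in the expansion of (M + c + d)^2
      absorb C; |c| + 1 keeps M and M + c nonnegative.\<close>
    define M where "M = C / (2 * d) + \<bar>c\<bar> + 1"
    have "0 \<le> C / (2 * d)" using \<open>0 < d\<close> by (simp add: C_def)
    then have M: "0 \<le> M" "0 \<le> M + c + d" and "C / (2 * d) \<le> M + c"
      using \<open>0 < d\<close> by (auto simp: M_def)
    then have M': "C \<le> 2 * (M + c) * d"
      using \<open>0 < d\<close> by (simp add: pos_divide_le_eq mult_ac)
    have "norm (A + of_real M) \<le> M + c + d"
    proof (rule norm_endo_leI[OF M(2)])
      fix u
      have "(norm (endo_apply (A + of_real M) u))\<^sup>2
          = (norm (endo_apply A u))\<^sup>2 + 2 * M * inner (endo_apply A u) u + M\<^sup>2 * (norm u)\<^sup>2"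
        unfolding power2_norm_eq_inner
        by (simp add: of_real_def endo.add_left endo.scaleR_left inner_add_left inner_add_right
            inner_commute power2_eq_square)
      also have "\<dots> \<le> C * (norm u)\<^sup>2 + 2 * M * (c * (norm u)\<^sup>2) + M\<^sup>2 * (norm u)\<^sup>2"
        using power_mono[OF norm_endo_apply[of A u], of 2] M(1)
        by (intro add_mono mult_left_mono A) (auto simp: C_def power_mult_distrib)
      also have "\<dots> = (C + 2 * M * c + M\<^sup>2) * (norm u)\<^sup>2"
        by (simp add: algebra_simps)
      also have "\<dots> \<le> (M + c + d)\<^sup>2 * (norm u)\<^sup>2"
      proof (rule mult_right_mono)
        have "(M + c + d)\<^sup>2 = 2 * (M + c) * d + 2 * M * c + M\<^sup>2 + c\<^sup>2 + d\<^sup>2"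
          by (simp add: power2_eq_square algebra_simps)
        then show "C + 2 * M * c + M\<^sup>2 \<le> (M + c + d)\<^sup>2"
          using M' zero_le_power2[of c] zero_le_power2[of d] by linarith
      qed simp
      finally have "(norm (endo_apply (A + of_real M) u))\<^sup>2 \<le> ((M + c + d) * norm u)\<^sup>2"
        by (simp add: power_mult_distrib)
      then show "norm (endo_apply (A + of_real M) u) \<le> (M + c + d) * norm u"
        by (rule power2_le_imp_le) (use M(2) in simp)
    qed
    have "exp A = exp (of_real (- M) + (A + of_real M))" by simp
    also have "\<dots> = exp (of_real (- M)) * exp (A + of_real M)"
      by (rule exp_add_commuting)
        (simp add: of_real_def scaleR_add_right)
    also have "norm \<dots> \<le> norm (exp (of_real (- M) :: 'a endo)) * norm (exp (A + of_real M))"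
      by (rule norm_mult_ineq)
    also have "\<dots> \<le> exp (- M) * exp (norm (A + of_real M))"
      using norm_exp[of "A + of_real M"] by (simp only: exp_of_real norm_of_real abs_exp_cancel)
        simp
    also have "\<dots> \<le> exp (- M) * exp (M + c + d)"
      using \<open>norm (A + of_real M) \<le> M + c + d\<close> by simp
    also have "\<dots> = exp (c + d)" by (simp flip: exp_add)
    finally show ?thesis .
  qed
  show ?thesis
  proof (cases "norm (exp A) = 0")
    case False
    then have pos: "0 < norm (exp A)" by simp
    \<comment> \<open>\<open>field_le_epsilon\<close> allows an additive error, so d tends to 0
      after taking logarithms.\<close>
    have "ln (norm (exp A)) \<le> c"
      by (rule field_le_epsilon) (metis bound pos exp_gt_zero ln_exp ln_le_cancel_iff)
    then have "exp (ln (norm (exp A))) \<le> exp c" by (simp only: exp_le_cancel_iff)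
    with pos show ?thesis by (simp only: exp_ln)
  qed simp
qed

section \<open>Weighted spaces as closed subspaces\<close>

text \<open>The factor sqrt w makes this an isometry from \<open>l2 X w\<close> onto the vectors
  that vanish off X. \<open>Abs_ell2\<close> is meaningful only for f in \<open>l2 X w\<close>,
  hence the membership premises below.\<close>

definition l2_embed :: "'a set \<Rightarrow> ('a \<Rightarrow> real) \<Rightarrow> ('a \<Rightarrow> real) \<Rightarrow> 'a ell2" where
  "l2_embed X w f = Abs_ell2 (\<lambda>x. if x \<in> X then f x * sqrt (w x) else 0)"

text \<open>A left inverse of \<open>l2_embed\<close> that is defined on all of \<open>ell2\<close>;
  embedding after restricting is the orthogonal projection onto the vectors supported in X.\<close>

definition l2_restrict :: "'a set \<Rightarrow> ('a \<Rightarrow> real) \<Rightarrow> 'a ell2 \<Rightarrow> ('a \<Rightarrow> real)" where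
  "l2_restrict X w u = (\<lambda>x. if x \<in> X then Rep_ell2 u x / sqrt (w x) else 0)"

definition point :: "'a \<Rightarrow> 'a \<Rightarrow> real" where "point x y = (if y = x then 1 else 0)"

lemma summable_on_if_iff:
  "(\<lambda>x. if x \<in> X then g x else 0) summable_on UNIV \<longleftrightarrow> g summable_on X"
  for g :: "'a \<Rightarrow> real"
  by (rule summable_on_cong_neutral) auto

locale weighted_set =
  fixes X :: "'a set" and w :: "'a \<Rightarrow> real"
  assumes weight_pos: "x \<in> X \<Longrightarrow> 0 < w x"
begin

lemma weight_nonneg [simp]: "x \<in> X \<Longrightarrow> 0 \<le> w x"
  and weight_nonzero [simp]: "x \<in> X \<Longrightarrow> w x \<noteq> 0"
  using weight_pos[of x] by auto

abbreviation "emb \<equiv> l2_embed X w"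
abbreviation "res \<equiv> l2_restrict X w"

lemma Rep_emb:
  assumes "f \<in> l2 X w"
  shows "Rep_ell2 (emb f) x = (if x \<in> X then f x * sqrt (w x) else 0)"
proof -
  have "(\<lambda>x. (f x)\<^sup>2 * w x) summable_on X"
    using assms by (simp add: l2_def)
  then have "(\<lambda>x. if x \<in> X then (f x)\<^sup>2 * w x else 0) summable_on UNIV"
    by (simp add: summable_on_if_iff)
  also have "(\<lambda>x. if x \<in> X then (f x)\<^sup>2 * w x else 0)
      = (\<lambda>x. (if x \<in> X then f x * sqrt (w x) else 0)\<^sup>2)"
    by (auto simp: power_mult_distrib)
  finally show ?thesis
    by (simp add: l2_embed_def Abs_ell2_inverse)
qed

lemma res_in_l2 [simp]: "res u \<in> l2 X w"
proof -
  have "(\<lambda>x. (res u x)\<^sup>2 * w x) summable_on X \<longleftrightarrow> (\<lambda>x. (Rep_ell2 u x)\<^sup>2) summable_on X"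
    by (intro summable_on_cong) (auto simp: l2_restrict_def power_divide)
  moreover have "(\<lambda>x. (Rep_ell2 u x)\<^sup>2) summable_on X"
    using ell2_square_summable by (rule summable_on_subset) auto
  ultimately show ?thesis
    by (simp add: l2_def l2_restrict_def)
qed

lemma l2_outside: "f \<in> l2 X w \<Longrightarrow> x \<notin> X \<Longrightarrow> f x = 0"
  by (simp add: l2_def)

lemma res_emb [simp]: "f \<in> l2 X w \<Longrightarrow> res (emb f) = f"
  by (auto simp: l2_restrict_def Rep_emb l2_outside)

lemma Rep_emb_res: "Rep_ell2 (emb (res u)) x = (if x \<in> X then Rep_ell2 u x else 0)"
  by (subst Rep_emb[OF res_in_l2]) (auto simp: l2_restrict_def)

lemma res_add: "res (u + v) = (\<lambda>x. res u x + res v x)"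
  by (auto simp: l2_restrict_def plus_ell2.rep_eq add_divide_distrib)

lemma res_diff: "res (u - v) = (\<lambda>x. res u x - res v x)"
  by (auto simp: l2_restrict_def minus_ell2.rep_eq diff_divide_distrib)

lemma res_scaleR: "res (c *\<^sub>R u) = (\<lambda>x. c * res u x)"
  by (auto simp: l2_restrict_def scaleR_ell2.rep_eq)

lemma l2_add: "f \<in> l2 X w \<Longrightarrow> g \<in> l2 X w \<Longrightarrow> (\<lambda>x. f x + g x) \<in> l2 X w"
  using res_in_l2[of "emb f + emb g"] by (simp add: res_add)

lemma l2_diff: "f \<in> l2 X w \<Longrightarrow> g \<in> l2 X w \<Longrightarrow> (\<lambda>x. f x - g x) \<in> l2 X w"
  using res_in_l2[of "emb f - emb g"] by (simp add: res_diff)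

lemma l2_scale: "f \<in> l2 X w \<Longrightarrow> (\<lambda>x. c * f x) \<in> l2 X w"
  using res_in_l2[of "c *\<^sub>R emb f"] by (simp add: res_scaleR)

lemma emb_add: "f \<in> l2 X w \<Longrightarrow> g \<in> l2 X w \<Longrightarrow> emb (\<lambda>x. f x + g x) = emb f + emb g"
  by (simp add: Rep_ell2_inject[symmetric] fun_eq_iff Rep_emb l2_add plus_ell2.rep_eq distrib_right)

lemma emb_diff: "f \<in> l2 X w \<Longrightarrow> g \<in> l2 X w \<Longrightarrow> emb (\<lambda>x. f x - g x) = emb f - emb g"
  by (simp add: Rep_ell2_inject[symmetric] fun_eq_iff Rep_emb l2_diff minus_ell2.rep_eq
      left_diff_distrib)

lemma emb_scale: "f \<in> l2 X w \<Longrightarrow> emb (\<lambda>x. c * f x) = c *\<^sub>R emb f"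
  by (simp add: Rep_ell2_inject[symmetric] fun_eq_iff Rep_emb l2_scale scaleR_ell2.rep_eq)

lemma inner_emb_emb:
  assumes "f \<in> l2 X w" "g \<in> l2 X w"
  shows "inner (emb f) (emb g) = l2_inner X w f g"
  unfolding inner_ell2.rep_eq l2_inner_def
  by (rule infsum_cong_neutral)
    (auto simp: Rep_emb assms weight_pos less_imp_le mult.assoc mult.left_commute[of "sqrt _"])

lemma norm_emb: "f \<in> l2 X w \<Longrightarrow> norm (emb f) = l2_norm X w f"
  by (simp add: norm_eq_sqrt_inner l2_norm_def inner_emb_emb)

lemma emb_inject: "f \<in> l2 X w \<Longrightarrow> g \<in> l2 X w \<Longrightarrow> emb f = emb g \<Longrightarrow> f = g"
  by (metis res_emb)

lemma norm_emb_res: "norm (emb (res u)) \<le> norm u"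
proof (rule norm_ell2_leI)
  fix J :: "'a set"
  assume "finite J"
  have "(\<Sum>x\<in>J. (Rep_ell2 (emb (res u)) x)\<^sup>2) \<le> (\<Sum>x\<in>J. (Rep_ell2 u x)\<^sup>2)"
    by (rule sum_mono) (simp add: Rep_emb_res)
  also have "\<dots> \<le> (norm u)\<^sup>2"
    using \<open>finite J\<close> by (rule ell2_finite_sum_le)
  finally show "(\<Sum>x\<in>J. (Rep_ell2 (emb (res u)) x)\<^sup>2) \<le> (norm u)\<^sup>2" .
qed simp

lemma bounded_linear_emb_res: "bounded_linear (\<lambda>u. emb (res u))"
  by (rule bounded_linear_intro[where K = 1])
    (simp_all add: res_add emb_add res_scaleR emb_scale norm_emb_res)

lemma inner_emb_res: "inner (emb (res u)) v = inner u (emb (res v))"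
  unfolding inner_ell2.rep_eq by (rule infsum_cong) (simp add: Rep_emb_res)

lemma inner_emb_left: "f \<in> l2 X w \<Longrightarrow> inner (emb f) (emb (res v)) = inner (emb f) v"
  using inner_emb_res[of "emb f" v] by simp

lemma point_eq: "x \<in> X \<Longrightarrow> point x = res (sqrt (w x) *\<^sub>R ell2_basis x)"
  using weight_pos[of x]
  by (auto simp: fun_eq_iff point_def l2_restrict_def scaleR_ell2.rep_eq ell2_basis.rep_eq)

lemma point_in_l2: "x \<in> X \<Longrightarrow> point x \<in> l2 X w"
  by (simp add: point_eq)

lemma emb_point: "x \<in> X \<Longrightarrow> emb (point x) = sqrt (w x) *\<^sub>R ell2_basis x"
  by (auto simp: Rep_ell2_inject[symmetric] fun_eq_iff Rep_emb point_in_l2 point_def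
      scaleR_ell2.rep_eq ell2_basis.rep_eq)

lemma l2_inner_point_left:
  assumes "x \<in> X" "f \<in> l2 X w"
  shows "l2_inner X w (point x) f = f x * w x"
  using assms weight_pos[of x]
  by (simp add: point_in_l2 emb_point inner_ell2_basis Rep_emb flip: inner_emb_emb)

lemma l2_inner_commute: "l2_inner X w f g = l2_inner X w g f"
  unfolding l2_inner_def by (simp add: mult.commute)

end

text \<open>\<open>l2_bounded_op\<close> constrains T on \<open>l2 X w\<close> alone. Every
  restricted vector lies there, so composing with \<open>l2_restrict\<close> gives a bounded
  operator that is linear on the whole of \<open>ell2\<close>.\<close>

lemma l2_bounded_op_bounded_linear:
  assumes "weighted_set X w" "weighted_set Y v" "l2_bounded_op X w Y v T"
  shows "bounded_linear (\<lambda>u. l2_embed Y v (T (l2_restrict X w u)))"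
proof -
  interpret X: weighted_set X w by fact
  interpret Y: weighted_set Y v by fact
  from assms(3) have T_in: "\<And>f. f \<in> l2 X w \<Longrightarrow> T f \<in> l2 Y v"
    and T_add: "\<And>f g. f \<in> l2 X w \<Longrightarrow> g \<in> l2 X w \<Longrightarrow> T (\<lambda>x. f x + g x) = (\<lambda>y. T f y + T g y)"
    and T_scale: "\<And>c f. f \<in> l2 X w \<Longrightarrow> T (\<lambda>x. c * f x) = (\<lambda>y. c * T f y)"
    and "\<exists>C. \<forall>f\<in>l2 X w. l2_norm Y v (T f) \<le> C * l2_norm X w f"
    unfolding l2_bounded_op_def by blast+
  then obtain C where C: "\<And>f. f \<in> l2 X w \<Longrightarrow> l2_norm Y v (T f) \<le> C * l2_norm X w f" by blast
  show ?thesis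
  proof (rule bounded_linear_intro[where K = "\<bar>C\<bar>"])
    fix u
    have "norm (Y.emb (T (X.res u))) \<le> C * norm (X.emb (X.res u))"
      using C[of "X.res u"] by (simp add: X.norm_emb Y.norm_emb T_in)
    also have "\<dots> \<le> \<bar>C\<bar> * norm u"
      using X.norm_emb_res[of u] by (intro mult_mono) auto
    finally show "norm (Y.emb (T (X.res u))) \<le> norm u * \<bar>C\<bar>" by (simp add: mult.commute)
  qed (simp_all add: X.res_add X.res_scaleR T_add T_scale T_in Y.emb_add Y.emb_scale)
qed

text \<open>The converse direction, used for constructed operators (adjoints, resolvents, sums,
  composites): linearity and boundedness are inherited from an operator between the unweighted
  spaces.\<close>

lemma l2_bounded_opI:
  assumes "weighted_set X w" "weighted_set Y v"
    and "bounded_linear L" and "\<And>f. f \<in> l2 X w \<Longrightarrow> T f = l2_restrict Y v (L (l2_embed X w f))"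
  shows "l2_bounded_op X w Y v T"
proof -
  interpret X: weighted_set X w by fact
  interpret Y: weighted_set Y v by fact
  interpret L: bounded_linear L by fact
  obtain C where C: "\<And>u. norm (L u) \<le> norm u * C" using L.bounded by blast
  have "l2_norm Y v (T f) \<le> C * l2_norm X w f" if "f \<in> l2 X w" for f
    using order_trans[OF Y.norm_emb_res C, of "X.emb f"] that
    by (simp add: assms(4) mult.commute flip: X.norm_emb Y.norm_emb)
  then show ?thesis
    unfolding l2_bounded_op_def
    by (auto simp: assms(4) X.l2_add X.l2_scale X.emb_add X.emb_scale L.add L.scaleR
        Y.res_add Y.res_scaleR)
qed

lemma l2_adjoint_bounded:
  assumes "weighted_set X w" "weighted_set Y v" "l2_bounded_op X w Y v T"
  shows l2_bounded_op_adjoint: "l2_bounded_op Y v X w (l2_adjoint X w Y v T)"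
    and l2_inner_adjoint: "\<And>f g. f \<in> l2 X w \<Longrightarrow> g \<in> l2 Y v \<Longrightarrow>
      l2_inner Y v (T f) g = l2_inner X w f (l2_adjoint X w Y v T g)"
proof -
  interpret X: weighted_set X w by fact
  interpret Y: weighted_set Y v by fact
  from assms(3) have T_in: "\<And>f. f \<in> l2 X w \<Longrightarrow> T f \<in> l2 Y v"
    unfolding l2_bounded_op_def by blast
  obtain T' where T': "bounded_linear T'"
      "\<And>u v'. inner (Y.emb (T (X.res u))) v' = inner u (T' v')"
    using ell2_adjoint_exists[OF l2_bounded_op_bounded_linear[OF assms]] by metis
  have adj_inner: "l2_inner Y v (T f) g = l2_inner X w f (X.res (T' (Y.emb g)))"
    if "f \<in> l2 X w" "g \<in> l2 Y v" for f g
    using that T'(2)[of "X.emb f" "Y.emb g"]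
    by (simp add: T_in X.inner_emb_left flip: X.inner_emb_emb Y.inner_emb_emb)
  have adj_eq: "l2_adjoint X w Y v T g = X.res (T' (Y.emb g))" if g: "g \<in> l2 Y v" for g
    unfolding l2_adjoint_def
  proof (rule the_equality)
    fix h
    assume h: "h \<in> l2 X w \<and> (\<forall>f\<in>l2 X w. l2_inner Y v (T f) g = l2_inner X w f h)"
    let ?k = "X.res (T' (Y.emb g))"
    \<comment> \<open>Uniqueness of the adjoint value: the identity is tested at the difference of
      two candidates.\<close>
    define d where "d = (\<lambda>x. h x - ?k x)"
    have d: "d \<in> l2 X w" unfolding d_def using h by (simp add: X.l2_diff)
    then have "l2_inner X w d h = l2_inner X w d ?k"
      using h adj_inner[OF _ g] by metis
    then have "inner (X.emb d) (X.emb d) = 0"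
      using d h by (subst (2) d_def) (simp add: X.emb_diff inner_diff_right X.inner_emb_emb)
    then have "X.emb h = X.emb ?k"
      using h by (simp add: d_def X.emb_diff)
    then show "h = ?k" using h by (intro X.emb_inject) auto
  qed (use adj_inner g in auto)
  show "l2_bounded_op Y v X w (l2_adjoint X w Y v T)"
    by (rule l2_bounded_opI[OF assms(2,1) T'(1) adj_eq])
  show "l2_inner Y v (T f) g = l2_inner X w f (l2_adjoint X w Y v T g)"
    if "f \<in> l2 X w" "g \<in> l2 Y v" for f g
    using that by (simp add: adj_inner adj_eq)
qed

context weighted_set
begin

text \<open>A preserves the embedded copy of \<open>l2 X w\<close> and agrees with T on it. Its
  action on the orthogonal complement is left free and is chosen by \<open>extension\<close>
  according to purpose.\<close>

definition represents :: "'a ell2 endo \<Rightarrow> (('a \<Rightarrow> real) \<Rightarrow> 'a \<Rightarrow> real) \<Rightarrow> bool" where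
  "represents A T \<longleftrightarrow> (\<forall>f\<in>l2 X w. T f \<in> l2 X w \<and> endo_apply A (emb f) = emb (T f))"

lemma represents_exp:
  assumes "represents A T" and f: "f \<in> l2 X w"
  shows l2_exp_in_l2: "l2_exp X w T f \<in> l2 X w"
    and emb_l2_exp: "emb (l2_exp X w T f) = endo_apply (exp A) (emb f)"
proof -
  have pow: "(T ^^ n) f \<in> l2 X w \<and> emb ((T ^^ n) f) = (endo_apply A ^^ n) (emb f)" for n
    using assms by (induction n) (auto simp: represents_def)
  define S where "S N x = (\<Sum>n<N. (T ^^ n) f x / fact n)" for N x
  have S: "S N \<in> l2 X w \<and> emb (S N) = (\<Sum>n<N. (endo_apply A ^^ n) (emb f) /\<^sub>R fact n)" for N
  proof (induction N)
    case 0
    have "S 0 = (\<lambda>x. 0 * f x)" by (simp add: S_def fun_eq_iff)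
    then show ?case using f by (simp only: l2_scale emb_scale) simp
  next
    case (Suc N)
    have "S (Suc N) = (\<lambda>x. S N x + (1 / fact N) * (T ^^ N) f x)"
      by (simp add: S_def fun_eq_iff)
    with Suc show ?case
      using pow[of N] by (simp only: l2_add l2_scale emb_add emb_scale) (simp add: inverse_eq_divide)
  qed
  have lim: "(\<lambda>N. emb (S N)) \<longlonglongrightarrow> endo_apply (exp A) (emb f)"
    using endo_exp_apply_sums[of A "emb f"] by (simp add: sums_def S)
  \<comment> \<open>The limit is restricted to X so that membership in \<open>l2 X w\<close> is
    immediate. Continuity of the projection then identifies both limits, which amounts to closedness
    of the subspace.\<close>
  define h where "h = res (endo_apply (exp A) (emb f))"
  have "res (emb (S N)) = S N" for N
    using S by (intro res_emb) blast
  with bounded_linear.tendsto[OF bounded_linear_emb_res lim]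
  have lim_h: "(\<lambda>N. emb (S N)) \<longlonglongrightarrow> emb h"
    unfolding h_def by simp
  have norm_diff: "l2_norm X w (\<lambda>x. S N x - h' x) = norm (emb (S N) - emb h')"
    if "h' \<in> l2 X w" for h' N
    using that S[of N] by (simp add: l2_diff emb_diff flip: norm_emb)
  have exp_eq: "l2_exp X w T f = h"
    unfolding l2_exp_def S_def[symmetric]
  proof (rule the_equality)
    show "h \<in> l2 X w \<and> (\<lambda>N. l2_norm X w (\<lambda>x. S N x - h x)) \<longlonglongrightarrow> 0"
      using lim_h norm_diff[of h] by (simp add: h_def tendsto_norm_zero LIM_zero)
  next
    fix h'
    assume h': "h' \<in> l2 X w \<and> (\<lambda>N. l2_norm X w (\<lambda>x. S N x - h' x)) \<longlonglongrightarrow> 0"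
    then have "(\<lambda>N. emb (S N)) \<longlonglongrightarrow> emb h'"
      using norm_diff[of h'] by (simp add: tendsto_norm_zero_iff LIM_zero_iff)
    then have "emb h' = emb h" using lim_h LIMSEQ_unique by blast
    then show "h' = h" using h' by (intro emb_inject) (auto simp: h_def)
  qed
  show "l2_exp X w T f \<in> l2 X w" by (simp add: exp_eq h_def)
  show "emb (l2_exp X w T f) = endo_apply (exp A) (emb f)"
    unfolding exp_eq using lim lim_h LIMSEQ_unique by blast
qed

end

section \<open>The numerical range and the bottom of the spectrum\<close>

lemma neumann_inverse:
  fixes x :: "'a::{real_normed_algebra_1, banach}"
  assumes "norm x < 1"
  obtains y where "(1 - x) * y = 1" "y * (1 - x) = 1"
proof -
  have "summable (\<lambda>n. norm x ^ n)"
    using assms by (simp add: summable_geometric)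
  then have sum: "summable (\<lambda>n. x ^ n)"
    by (rule summable_comparison_test'[where N = 0]) (rule norm_power_ineq)
  have "(\<Sum>n. x ^ n) = 1 + (\<Sum>n. x ^ Suc n)"
    using suminf_split_head[OF sum] by simp
  moreover have "(\<Sum>n. x ^ Suc n) = x * (\<Sum>n. x ^ n)"
    using suminf_mult[OF sum, of x] by simp
  moreover have "(\<Sum>n. x ^ Suc n) = (\<Sum>n. x ^ n) * x"
    using suminf_mult2[OF sum, of x] by (simp only: power_Suc2)
  ultimately show ?thesis
    by (intro that[of "\<Sum>n. x ^ n"]) (simp_all add: algebra_simps)
qed

context weighted_set
begin

text \<open>T on the embedded subspace and the scalar c on its complement. The choice c = 0 adds
  nothing; if c is a lower bound of the form of T, that bound holds on all of
  \<open>ell2\<close>.\<close>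

definition extension :: "real \<Rightarrow> (('a \<Rightarrow> real) \<Rightarrow> 'a \<Rightarrow> real) \<Rightarrow> 'a ell2 endo" where
  "extension c T = Endo (\<lambda>u. emb (T (res u)) + c *\<^sub>R (u - emb (res u)))"

lemma extension_apply:
  assumes "l2_bounded_op X w X w T"
  shows "endo_apply (extension c T) u = emb (T (res u)) + c *\<^sub>R (u - emb (res u))"
proof -
  have "bounded_linear (\<lambda>u. emb (T (res u)) + c *\<^sub>R (u - emb (res u)))"
    by (intro bounded_linear_add bounded_linear_const_scaleR bounded_linear_sub
        bounded_linear_ident bounded_linear_emb_res
        l2_bounded_op_bounded_linear[OF weighted_set_axioms weighted_set_axioms assms])
  then show ?thesis by (simp add: extension_def endo_apply_Endo)
qed

lemma extension_symmetric:
  assumes T: "l2_bounded_op X w X w T"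
    and sym: "\<And>f g. f \<in> l2 X w \<Longrightarrow> g \<in> l2 X w \<Longrightarrow> l2_inner X w (T f) g = l2_inner X w f (T g)"
  shows "inner (endo_apply (extension c T) u) v = inner u (endo_apply (extension c T) v)"
proof -
  have T_in: "T f \<in> l2 X w" if "f \<in> l2 X w" for f
    using T that by (simp add: l2_bounded_op_def)
  have "inner (emb (T (res u))) v = inner u (emb (T (res v)))"
    using inner_emb_res[of u "emb (T (res v))"] inner_emb_res[of v "emb (T (res u))"]
      sym[of "res u" "res v"]
    by (simp add: T_in inner_commute flip: inner_emb_emb)
  then show ?thesis
    by (simp add: extension_apply[OF T] inner_add_left inner_add_right inner_diff_left
        inner_diff_right inner_emb_res)
qed

lemma represents_extension: "l2_bounded_op X w X w T \<Longrightarrow> represents (extension c T) T"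
  by (simp add: represents_def extension_apply) (simp add: l2_bounded_op_def)

lemma represents_scale:
  "represents A T \<Longrightarrow> represents (c *\<^sub>R A) (\<lambda>f x. c * T f x)"
  by (auto simp: represents_def l2_scale emb_scale endo.scaleR_left)

text \<open>From A - \<mu> = -\<mu> (1 - A / \<mu>) and a Neumann series. It bounds the spectrum
  from below, which is what gives the infimum in \<open>l2_spectrum_bottom\<close> its
  meaning.\<close>

lemma resolvent_below_norm:
  assumes T: "l2_bounded_op X w X w T" and "\<mu> < - norm (extension 0 T)"
  shows "\<mu> \<in> l2_resolvent_set X w T"
proof -
  define A where "A = extension 0 T"
  have A: "endo_apply A u = emb (T (res u))" for u
    using extension_apply[OF T, of 0] by (simp add: A_def)
  have T_in: "T f \<in> l2 X w" if "f \<in> l2 X w" for f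
    using T that by (simp add: l2_bounded_op_def)
  have "\<mu> < 0" and "norm A < - \<mu>"
    using assms(2) norm_ge_zero[of A] unfolding A_def by linarith+
  define x where "x = (1 / \<mu>) *\<^sub>R A"
  have "norm x < 1"
    using \<open>norm A < - \<mu>\<close> \<open>\<mu> < 0\<close> by (simp add: x_def neg_less_divide_eq)
  then obtain y where y: "(1 - x) * y = 1" "y * (1 - x) = 1"
    by (rule neumann_inverse)
  define S where "S = (- 1 / \<mu>) *\<^sub>R y"
  have "S * (A - \<mu> *\<^sub>R 1) = y * (1 - x)" "(A - \<mu> *\<^sub>R 1) * S = (1 - x) * y"
    using \<open>\<mu> < 0\<close> by (simp_all add: S_def x_def algebra_simps)
  then have S: "endo_apply S (endo_apply A u - \<mu> *\<^sub>R u) = u"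
    "endo_apply A (endo_apply S u) - \<mu> *\<^sub>R endo_apply S u = u" for u
    using endo_apply_times[of S "A - \<mu> *\<^sub>R 1" u] endo_apply_times[of "A - \<mu> *\<^sub>R 1" S u]
    by (simp_all add: y endo.diff_left endo.scaleR_left)
  define R where "R f = res (endo_apply S (emb f))" for f
  have "l2_bounded_op X w X w R"
    by (rule l2_bounded_opI[OF weighted_set_axioms weighted_set_axioms endo.bounded_linear_right])
      (rule R_def)
  moreover have "R (\<lambda>x. T f x - \<mu> * f x) = f" if f: "f \<in> l2 X w" for f
    using S(1)[of "emb f"] f by (simp add: R_def emb_diff emb_scale T_in l2_scale A)
  moreover have "(\<lambda>x. T (R f) x - \<mu> * R f x) = f" if f: "f \<in> l2 X w" for f
    using arg_cong[OF S(2)[of "emb f"], of res] f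
    by (simp add: R_def res_diff res_scaleR T_in A)
  ultimately show ?thesis
    unfolding l2_resolvent_set_def by blast
qed

text \<open>If the infimum \<open>m\<close> of the quadratic form were in the resolvent set, the Cauchy-Schwarz
  inequality for the positive form of \<open>T - m\<close> would give \<open>\<langle>(T - m) f, f\<rangle> \<ge> \<epsilon> \<parallel>f\<parallel>\<^sup>2\<close> for some
  \<open>\<epsilon> > 0\<close>.\<close>

lemma spectrum_bottom_le_quadratic_form:
  assumes T: "l2_bounded_op X w X w T"
    and sym: "\<And>f g. f \<in> l2 X w \<Longrightarrow> g \<in> l2 X w \<Longrightarrow> l2_inner X w (T f) g = l2_inner X w f (T g)"
    and f0: "f0 \<in> l2 X w"
  shows "l2_spectrum_bottom X w T * l2_inner X w f0 f0 \<le> l2_inner X w (T f0) f0"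
proof (rule ccontr)
  define lam where "lam = l2_spectrum_bottom X w T"
  define A where "A = extension 0 T"
  have A: "endo_apply A u = emb (T (res u))" for u
    using extension_apply[OF T, of 0] by (simp add: A_def)
  have T_in: "T f \<in> l2 X w" if "f \<in> l2 X w" for f
    using T that by (simp add: l2_bounded_op_def)
  have A_sym: "inner (endo_apply A u) v = inner u (endo_apply A v)" for u v
    unfolding A_def by (rule extension_symmetric[OF T sym])
  assume "\<not> ?thesis"
  then have f0_less: "inner (endo_apply A (emb f0)) (emb f0) < lam * (norm (emb f0))\<^sup>2"
    using f0 by (simp add: lam_def A T_in power2_norm_eq_inner flip: inner_emb_emb)
  \<comment> \<open>The Rayleigh quotient. By the assumption to be refuted its infimum m lies below
    \<open>lam\<close>, hence outside the spectrum.\<close>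
  define q where "q f = inner (endo_apply A (emb f)) (emb f) / (norm (emb f))\<^sup>2" for f
  define Q where "Q = q ` {f \<in> l2 X w. emb f \<noteq> 0}"
  define m where "m = Inf Q"
  have "emb f0 \<noteq> 0" using f0_less by auto
  have q_lower: "- norm A \<le> q f" if "emb f \<noteq> 0" for f
  proof -
    have "\<bar>inner (endo_apply A (emb f)) (emb f)\<bar> \<le> norm A * norm (emb f) * norm (emb f)"
      using Cauchy_Schwarz_ineq2 norm_endo_apply
      by (meson mult_right_mono norm_ge_zero order_trans)
    then show ?thesis using that by (simp add: q_def field_simps power2_eq_square)
  qed
  have Q: "Q \<noteq> {}" "bdd_below Q"
    using f0 \<open>emb f0 \<noteq> 0\<close> q_lower by (auto simp: Q_def intro!: bdd_belowI[of _ "- norm A"])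
  have "q f0 < lam"
    using f0_less \<open>emb f0 \<noteq> 0\<close> by (simp add: q_def divide_less_eq)
  moreover have "m \<le> q f0"
    unfolding m_def using Q f0 \<open>emb f0 \<noteq> 0\<close> by (intro cInf_lower) (auto simp: Q_def)
  ultimately have "m < lam" by simp
  have "bdd_below (l2_spectrum X w T)"
    using resolvent_below_norm[OF T]
    by (intro bdd_belowI[of _ "- norm (extension 0 T)"]) (force simp: l2_spectrum_def)
  then have "m \<notin> l2_spectrum X w T"
    using \<open>m < lam\<close> cInf_lower[of m "l2_spectrum X w T"]
    by (auto simp: lam_def l2_spectrum_bottom_def)
  then obtain R where R: "l2_bounded_op X w X w R"
      "\<And>f. f \<in> l2 X w \<Longrightarrow> R (\<lambda>x. T f x - m * f x) = f"
    unfolding l2_spectrum_def l2_resolvent_set_def by auto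
  then obtain C where C: "\<And>f. f \<in> l2 X w \<Longrightarrow> l2_norm X w (R f) \<le> C * l2_norm X w f"
    unfolding l2_bounded_op_def by blast
  define B where "B = A - m *\<^sub>R 1"
  have B: "endo_apply B u = endo_apply A u - m *\<^sub>R u" for u
    by (simp add: B_def endo.diff_left endo.scaleR_left)
  define b where "b u = inner (endo_apply B u) u" for u
  have b_emb: "b (emb f) = (q f - m) * (norm (emb f))\<^sup>2" for f
    by (cases "emb f = 0")
      (simp_all add: b_def B q_def inner_diff_left power2_norm_eq_inner left_diff_distrib endo.zero_right)
  have b_nonneg: "0 \<le> b (emb f)" if "f \<in> l2 X w" for f
  proof (cases "emb f = 0")
    case False
    then have "m \<le> q f"
      unfolding m_def using Q that by (intro cInf_lower) (auto simp: Q_def)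
    then show ?thesis by (simp add: b_emb)
  qed (simp add: b_def)
  define K where "K = norm B + 1"
  have "0 < K" unfolding K_def by (simp add: add_nonneg_pos)
  have coercive: "(norm (endo_apply B (emb f)))\<^sup>2 \<le> K * b (emb f)" if f: "f \<in> l2 X w" for f
  proof -
    define g where "g = (\<lambda>x. T f x - m * f x)"
    have g: "g \<in> l2 X w" "emb g = endo_apply B (emb f)"
      using f by (auto simp: g_def B A l2_diff l2_scale T_in emb_diff emb_scale)
    define n where "n = (norm (emb g))\<^sup>2"
    have "b (emb g) \<le> norm B * norm (emb g) * norm (emb g)"
      unfolding b_def using norm_cauchy_schwarz norm_endo_apply
      by (meson mult_right_mono norm_ge_zero order_trans)
    also have "\<dots> \<le> K * n"
      by (simp add: K_def n_def power2_eq_square distrib_right)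
    finally have bg: "b (emb g) \<le> K * n" .
    \<comment> \<open>Positivity of b at f - g / K, where g is (T - m) f: the cross term is -2 n / K
      and the quadratic term is at most n / K, which leaves n <= K b(f). The factor 1 / K minimises
      this bound.\<close>
    have "0 \<le> b (emb (\<lambda>x. f x - (1 / K) * g x))"
      using f g by (intro b_nonneg l2_diff l2_scale)
    also have "emb (\<lambda>x. f x - (1 / K) * g x) = emb f - (1 / K) *\<^sub>R emb g"
      using f g(1) by (simp only: emb_diff emb_scale l2_scale)
    also have "b \<dots> = b (emb f) - 2 / K * inner (endo_apply B (emb f)) (emb g)
        + (1 / K)\<^sup>2 * b (emb g)"
    proof -
      have "inner (endo_apply B (emb g)) (emb f) = inner (endo_apply B (emb f)) (emb g)"
        unfolding B inner_diff_left using A_sym[of "emb g" "emb f"] by (simp add: inner_commute)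
      then show ?thesis
        by (simp add: b_def endo.diff_right endo.scaleR_right inner_diff_left inner_diff_right
            power2_eq_square diff_divide_distrib)
    qed
    also have "inner (endo_apply B (emb f)) (emb g) = n"
      by (simp add: g n_def power2_norm_eq_inner)
    also have "(1 / K)\<^sup>2 * b (emb g) \<le> (1 / K)\<^sup>2 * (K * n)"
      using bg by (intro mult_left_mono) auto
    finally show ?thesis
      using \<open>0 < K\<close> by (simp add: g n_def field_simps power2_eq_square)
  qed
  define C' where "C' = \<bar>C\<bar> + 1"
  have "0 < C'" by (simp add: C'_def add_nonneg_pos)
  \<comment> \<open>The resolvent bounds |f| by C' |g|, and \<open>coercive\<close> bounds |g|^2 by
    K b(f). Dividing by |f|^2 gives a gap above m that does not depend on f, against the choice of m
    as infimum.\<close>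
  have "m + 1 / (C'\<^sup>2 * K) \<le> q f" if f: "f \<in> l2 X w" "emb f \<noteq> 0" for f
  proof -
    define g where "g = (\<lambda>x. T f x - m * f x)"
    have g: "g \<in> l2 X w" "emb g = endo_apply B (emb f)"
      using f by (auto simp: g_def B A l2_diff l2_scale T_in emb_diff emb_scale)
    have "norm (emb f) \<le> C * norm (emb g)"
      using C[OF g(1)] R(2)[OF f(1)] by (simp add: norm_emb f g(1) flip: g_def)
    also have "\<dots> \<le> C' * norm (emb g)"
      by (intro mult_right_mono) (auto simp: C'_def)
    finally have "(norm (emb f))\<^sup>2 \<le> (C' * norm (emb g))\<^sup>2"
      by (intro power_mono) auto
    also have "\<dots> \<le> C'\<^sup>2 * (K * b (emb f))"
      unfolding power_mult_distrib g(2) by (intro mult_left_mono coercive f) auto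
    also have "\<dots> = C'\<^sup>2 * K * (q f - m) * (norm (emb f))\<^sup>2"
      by (simp add: b_emb)
    finally have "1 \<le> C'\<^sup>2 * K * (q f - m)"
      using f(2) by simp
    then show ?thesis
      using \<open>0 < C'\<close> \<open>0 < K\<close> by (simp add: field_simps)
  qed
  then have "m + 1 / (C'\<^sup>2 * K) \<le> m"
    using Q(1) by (subst (2) m_def, intro cInf_greatest) (auto simp: Q_def)
  moreover have "0 < C'\<^sup>2 * K"
    using \<open>0 < C'\<close> \<open>0 < K\<close> by simp
  ultimately show False by simp
qed

end

section \<open>Exponentially weighted estimates\<close>

definition multiplication :: "('a \<Rightarrow> real) \<Rightarrow> 'a ell2 \<Rightarrow> 'a ell2" where
  "multiplication m u = Abs_ell2 (\<lambda>x. m x * Rep_ell2 u x)"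

lemma
  assumes m: "\<And>x. \<bar>m x\<bar> \<le> c"
  shows Rep_multiplication: "Rep_ell2 (multiplication m u) x = m x * Rep_ell2 u x"
    and bounded_linear_multiplication: "bounded_linear (multiplication m)"
proof -
  have "0 \<le> c" using m abs_ge_zero order_trans by blast
  have sum_le: "(\<Sum>x\<in>J. (m x * Rep_ell2 u x)\<^sup>2) \<le> (c * norm u)\<^sup>2" if "finite J" for J u
  proof -
    have "(\<Sum>x\<in>J. (m x * Rep_ell2 u x)\<^sup>2) \<le> (\<Sum>x\<in>J. c\<^sup>2 * (Rep_ell2 u x)\<^sup>2)"
    proof (rule sum_mono)
      fix x
      have "(m x)\<^sup>2 \<le> c\<^sup>2" using power_mono[OF m[of x] abs_ge_zero, of 2] by simp
      then show "(m x * Rep_ell2 u x)\<^sup>2 \<le> c\<^sup>2 * (Rep_ell2 u x)\<^sup>2"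
        unfolding power_mult_distrib by (rule mult_right_mono) simp
    qed
    also have "\<dots> \<le> c\<^sup>2 * (norm u)\<^sup>2"
      unfolding sum_distrib_left[symmetric]
      by (intro mult_left_mono ell2_finite_sum_le that) simp
    finally show ?thesis by (simp add: power_mult_distrib)
  qed
  have rep: "Rep_ell2 (multiplication m u) x = m x * Rep_ell2 u x" for u x
    using square_summableI[OF sum_le] by (simp add: multiplication_def Abs_ell2_inverse)
  show "Rep_ell2 (multiplication m u) x = m x * Rep_ell2 u x" by (rule rep)
  show "bounded_linear (multiplication m)"
  proof (rule bounded_linear_intro[where K = c])
    show "norm (multiplication m u) \<le> norm u * c" for u
    proof (rule norm_ell2_leI)
      show "0 \<le> norm u * c" using \<open>0 \<le> c\<close> by simp
      show "(\<Sum>x\<in>J. (Rep_ell2 (multiplication m u) x)\<^sup>2) \<le> (norm u * c)\<^sup>2" if "finite J" for J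
        using sum_le[OF that, of u] by (simp add: rep mult.commute)
    qed
  qed (simp_all add: Rep_ell2_inject[symmetric] fun_eq_iff rep plus_ell2.rep_eq
      scaleR_ell2.rep_eq algebra_simps)
qed

text \<open>Finitely supported vectors are dense. The conjugated form can therefore be estimated as
  a finite matrix, whose sums may be rearranged freely.\<close>

lemma ell2_closed_property:
  assumes "\<And>J. finite J \<Longrightarrow> \<phi> (\<Sum>x\<in>J. Rep_ell2 u x *\<^sub>R ell2_basis x) \<le> (0 :: real)"
    and "isCont \<phi> u"
  shows "\<phi> u \<le> 0"
proof (rule tendsto_upperbound)
  have "((\<lambda>J. \<Sum>x\<in>J. Rep_ell2 u x *\<^sub>R ell2_basis x) \<longlongrightarrow> u) (finite_subsets_at_top UNIV)"
    using ell2_expansion unfolding has_sum_def .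
  then show "((\<lambda>J. \<phi> (\<Sum>x\<in>J. Rep_ell2 u x *\<^sub>R ell2_basis x)) \<longlongrightarrow> \<phi> u)
      (finite_subsets_at_top UNIV)"
    by (rule isCont_tendsto_compose[OF assms(2)])
  show "\<forall>\<^sub>F J in finite_subsets_at_top UNIV.
      \<phi> (\<Sum>x\<in>J. Rep_ell2 u x *\<^sub>R ell2_basis x) \<le> 0"
    by (intro eventually_finite_subsets_at_top_weakI assms(1))
qed simp

text \<open>The symmetric part of the conjugated matrix \<open>a\<^sub>x\<^sub>y exp (\<omega> y - \<omega> x)\<close> is
  \<open>a\<^sub>x\<^sub>y cosh (\<omega> x - \<omega> y)\<close>, which differs from \<open>a\<^sub>x\<^sub>y\<close> by a matrix controlled by Schur's test with
  the weights \<open>v\<close>.\<close>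

lemma conjugated_form_bound:
  fixes a \<beta> :: "'a \<Rightarrow> 'a \<Rightarrow> real" and v \<omega> c :: "'a \<Rightarrow> real"
  assumes sym: "\<And>x y. a x y = a y x" "\<And>x y. \<beta> x y = \<beta> y x"
    and v: "\<And>x. 0 < v x"
    and a: "\<And>x y. x \<noteq> y \<Longrightarrow> \<bar>a x y\<bar> \<le> \<beta> x y / (v x * v y)"
    and \<beta>: "\<And>x. (\<Sum>y\<in>J. \<beta> x y * (cosh (\<omega> x - \<omega> y) - 1)) \<le> \<kappa> * (v x)\<^sup>2"
  shows "(\<Sum>x\<in>J. \<Sum>y\<in>J. c x * c y * a x y) - \<kappa> * (\<Sum>x\<in>J. (c x)\<^sup>2)
    \<le> (\<Sum>x\<in>J. \<Sum>y\<in>J. exp (\<omega> y - \<omega> x) * (c x * c y * a x y))"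
proof -
  define h where "h x y = cosh (\<omega> x - \<omega> y) - 1" for x y
  have h: "0 \<le> h x y" "h x y = h y x" "h x x = 0" for x y
    using cosh_real_ge_1[of "\<omega> x - \<omega> y"] cosh_minus[of "\<omega> x - \<omega> y"] by (auto simp: h_def)
  define p where "p x y = c x * c y * a x y" for x y
  have p: "p x y = p y x" for x y using sym(1)[of x y] by (simp add: p_def)
  define S where "S = (\<Sum>x\<in>J. \<Sum>y\<in>J. exp (\<omega> y - \<omega> x) * p x y)"
  have "S = (\<Sum>x\<in>J. \<Sum>y\<in>J. exp (\<omega> x - \<omega> y) * p x y)"
    unfolding S_def by (subst sum.swap) (simp add: p)
  then have "2 * S = (\<Sum>x\<in>J. \<Sum>y\<in>J. exp (\<omega> y - \<omega> x) * p x y + exp (\<omega> x - \<omega> y) * p x y)"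
    by (simp add: S_def sum.distrib)
  also have "\<dots> = (\<Sum>x\<in>J. \<Sum>y\<in>J. 2 * (h x y * p x y) + 2 * p x y)"
    by (intro sum.cong refl) (simp add: h_def cosh_def algebra_simps)
  also have "\<dots> = 2 * ((\<Sum>x\<in>J. \<Sum>y\<in>J. h x y * p x y) + (\<Sum>x\<in>J. \<Sum>y\<in>J. p x y))"
    by (simp add: sum.distrib sum_distrib_left)
  finally have S: "S = (\<Sum>x\<in>J. \<Sum>y\<in>J. h x y * p x y) + (\<Sum>x\<in>J. \<Sum>y\<in>J. p x y)" by simp
  \<comment> \<open>With s = |c x| / v x and t = |c y| / v y, the inequality 2 s t <= s^2 + t^2
    splits an entry into two halves whose row sums \<beta> controls. On the diagonal h vanishes, so
    diagonal entries contribute nothing to the error.\<close>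
  define r where "r x y = \<beta> x y * h x y * (c x / v x)\<^sup>2" for x y
  have term_le: "- (h x y * p x y) \<le> (r x y + r y x) / 2" for x y
  proof (cases "x = y")
    case False
    define s t where "s = \<bar>c x\<bar> / v x" and "t = \<bar>c y\<bar> / v y"
    have "0 \<le> \<beta> x y / (v x * v y)" using a[OF False] abs_ge_zero order_trans by blast
    then have "0 \<le> \<beta> x y" 
      using mult_pos_pos[OF v[of x] v[of y]] by (simp only: zero_le_divide_iff) auto
    have "2 * (s * t) \<le> s\<^sup>2 + t\<^sup>2" using zero_le_power2[of "s - t"] by (simp add: power2_diff)
    have "- (h x y * p x y) \<le> h x y * (\<bar>c x\<bar> * \<bar>c y\<bar> * \<bar>a x y\<bar>)"
      using abs_ge_minus_self[of "h x y * p x y"] h(1)[of x y] by (simp add: p_def abs_mult)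
    also have "\<dots> \<le> h x y * (\<bar>c x\<bar> * \<bar>c y\<bar> * (\<beta> x y / (v x * v y)))"
      using a[OF False] h(1) by (intro mult_left_mono) auto
    also have "\<dots> = h x y * \<beta> x y * (s * t)"
      by (simp add: s_def t_def)
    also have "\<dots> \<le> h x y * \<beta> x y * ((s\<^sup>2 + t\<^sup>2) / 2)"
      using \<open>2 * (s * t) \<le> s\<^sup>2 + t\<^sup>2\<close> h(1)[of x y] \<open>0 \<le> \<beta> x y\<close> by (intro mult_left_mono) auto
    also have "\<dots> = (r x y + r y x) / 2"
      using h(2)[of x y] sym(2)[of x y]
      by (simp add: r_def s_def t_def power_divide algebra_simps add_divide_distrib)
    finally show ?thesis .
  qed (simp add: h r_def)
  have "- (\<Sum>x\<in>J. \<Sum>y\<in>J. h x y * p x y) \<le> (\<Sum>x\<in>J. \<Sum>y\<in>J. (r x y + r y x) / 2)"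
    unfolding sum_negf[symmetric] by (intro sum_mono term_le)
  also have "\<dots> = ((\<Sum>x\<in>J. \<Sum>y\<in>J. r x y) + (\<Sum>x\<in>J. \<Sum>y\<in>J. r y x)) / 2"
    by (simp add: sum.distrib flip: sum_divide_distrib)
  also have "(\<Sum>x\<in>J. \<Sum>y\<in>J. r y x) = (\<Sum>x\<in>J. \<Sum>y\<in>J. r x y)"
    by (rule sum.swap)
  also have "((\<Sum>x\<in>J. \<Sum>y\<in>J. r x y) + (\<Sum>x\<in>J. \<Sum>y\<in>J. r x y)) / 2
      = (\<Sum>x\<in>J. (\<Sum>y\<in>J. \<beta> x y * h x y) * (c x / v x)\<^sup>2)"
    by (simp add: r_def sum_distrib_right)
  also have "\<dots> \<le> (\<Sum>x\<in>J. \<kappa> * (v x)\<^sup>2 * (c x / v x)\<^sup>2)"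
    using \<beta> by (intro sum_mono mult_right_mono) (auto simp: h_def)
  also have "\<dots> = (\<Sum>x\<in>J. \<kappa> * (c x)\<^sup>2)"
    using v by (intro sum.cong refl) (simp add: power_divide less_imp_neq[THEN not_sym])
  finally show ?thesis
    using S by (simp add: S_def p_def flip: sum_distrib_left)
qed

text \<open>Let D and E be multiplication by \<open>exp \<omega>\<close> and
  \<open>exp (- \<omega>)\<close>. D fixes f because \<omega> = 0 on its support, and E shrinks g by
  exp(-r) because \<omega> >= r on its support. Inserting E D = 1 turns the pairing of exp(-tA) f
  with g into that of exp(-tB) f with E g, where B = D A E.\<close>

lemma ell2_exp_weighted_bound:
  fixes A :: "'a ell2 endo" and \<beta> :: "'a \<Rightarrow> 'a \<Rightarrow> real" and v \<omega> :: "'a \<Rightarrow> real"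
  assumes A_sym: "\<And>u z. inner (endo_apply A u) z = inner u (endo_apply A z)"
    and A_lower: "\<And>u. lam * (norm u)\<^sup>2 \<le> inner (endo_apply A u) u"
    and \<beta>_sym: "\<And>x y. \<beta> x y = \<beta> y x"
    and v: "\<And>x. 0 < v x"
    and A_le: "\<And>x y. x \<noteq> y \<Longrightarrow>
      \<bar>inner (endo_apply A (ell2_basis x)) (ell2_basis y)\<bar> \<le> \<beta> x y / (v x * v y)"
    and \<beta>: "\<And>x J. finite J \<Longrightarrow> (\<Sum>y\<in>J. \<beta> x y * (cosh (\<omega> x - \<omega> y) - 1)) \<le> \<kappa> * (v x)\<^sup>2"
    and \<omega>: "\<And>x. 0 \<le> \<omega> x" "\<And>x. \<omega> x \<le> M"
    and f: "\<And>x. Rep_ell2 f x \<noteq> 0 \<Longrightarrow> \<omega> x = 0"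
    and g: "\<And>x. Rep_ell2 g x \<noteq> 0 \<Longrightarrow> r \<le> \<omega> x"
    and "0 \<le> t"
  shows "\<bar>inner (endo_apply (exp ((- t) *\<^sub>R A)) f) g\<bar>
    \<le> exp (- lam * t + \<kappa> * t - r) * norm f * norm g"
proof -
  \<comment> \<open>The upper bound on \<omega> makes D bounded; \<omega> >= 0 makes E a
    contraction.\<close>
  have bounds: "\<bar>exp (\<omega> x)\<bar> \<le> exp M" "\<bar>exp (- \<omega> x)\<bar> \<le> 1" for x using \<omega>[of x] by auto
  define D where "D = Endo (multiplication (\<lambda>x. exp (\<omega> x)))"
  define E where "E = Endo (multiplication (\<lambda>x. exp (- \<omega> x)))"
  have D: "Rep_ell2 (endo_apply D u) x = exp (\<omega> x) * Rep_ell2 u x" for u x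
    by (simp add: D_def endo_apply_Endo bounded_linear_multiplication[OF bounds(1)]
        Rep_multiplication[OF bounds(1)])
  have E: "Rep_ell2 (endo_apply E u) x = exp (- \<omega> x) * Rep_ell2 u x" for u x
    by (simp add: E_def endo_apply_Endo bounded_linear_multiplication[OF bounds(2)]
        Rep_multiplication[OF bounds(2)])
  have ED: "E * D = 1"
    by (rule endo_eqI)
      (simp add: Rep_ell2_inject[symmetric] fun_eq_iff D E flip: mult.assoc exp_add)
  have D_basis: "endo_apply D (ell2_basis x) = exp (\<omega> x) *\<^sub>R ell2_basis x" for x
    by (simp add: Rep_ell2_inject[symmetric] fun_eq_iff D scaleR_ell2.rep_eq ell2_basis.rep_eq)
  have E_basis: "endo_apply E (ell2_basis x) = exp (- \<omega> x) *\<^sub>R ell2_basis x" for x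
    by (simp add: Rep_ell2_inject[symmetric] fun_eq_iff E scaleR_ell2.rep_eq ell2_basis.rep_eq)
  have D_sym: "inner (endo_apply D u) z = inner u (endo_apply D z)" for u z
    unfolding inner_ell2.rep_eq D by (simp add: ac_simps)
  have E_sym: "inner (endo_apply E u) z = inner u (endo_apply E z)" for u z
    unfolding inner_ell2.rep_eq E by (simp add: ac_simps)
  define B where "B = D * A * E"
  define a where "a x y = inner (endo_apply A (ell2_basis x)) (ell2_basis y)" for x y
  have lower: "(lam - \<kappa>) * (norm u)\<^sup>2 \<le> inner (endo_apply B u) u" for u
  proof -
    define \<phi> where "\<phi> u = (lam - \<kappa>) * inner u u - inner (endo_apply B u) u" for u
    have "\<phi> u \<le> 0"
    proof (rule ell2_closed_property)
      show "isCont \<phi> u"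
        unfolding \<phi>_def
        by (intro continuous_intros bounded_linear.isCont[OF endo.bounded_linear_right])
    next
      fix J :: "'a set" assume J: "finite J"
      define z where "z = (\<Sum>x\<in>J. Rep_ell2 u x *\<^sub>R ell2_basis x)"
      let ?c = "Rep_ell2 u"
      have Az: "inner (endo_apply A z) z = (\<Sum>x\<in>J. \<Sum>y\<in>J. ?c x * ?c y * a x y)"
        by (simp add: z_def a_def endo.sum_right endo.scaleR_right inner_sum_left inner_sum_right
            mult.assoc sum_distrib_left)
          (subst sum.swap, simp add: mult.left_commute)
      have "endo_apply E z = (\<Sum>x\<in>J. (exp (- \<omega> x) * ?c x) *\<^sub>R ell2_basis x)"
        "endo_apply D z = (\<Sum>x\<in>J. (exp (\<omega> x) * ?c x) *\<^sub>R ell2_basis x)"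
        by (simp_all add: z_def D_basis E_basis endo.sum_right endo.scaleR_right mult.commute)
      then have Bz: "inner (endo_apply B z) z
          = (\<Sum>x\<in>J. \<Sum>y\<in>J. exp (\<omega> y - \<omega> x) * (?c x * ?c y * a x y))"
        by (simp add: B_def D_sym a_def endo.sum_right endo.scaleR_right inner_sum_left
            inner_sum_right sum_distrib_left exp_diff exp_minus field_simps)
      have zz: "inner z z = (\<Sum>x\<in>J. (?c x)\<^sup>2)"
      proof -
        have "inner z z = (\<Sum>x\<in>J. ?c x * Rep_ell2 z x)"
          by (subst (1) z_def) (simp add: inner_sum_left inner_ell2_basis)
        then show ?thesis
          using J by (simp add: z_def Rep_ell2_finite_expansion power2_eq_square)
      qed
      have "inner (endo_apply A z) z - \<kappa> * inner z z \<le> inner (endo_apply B z) z"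
        unfolding Az Bz zz
        by (rule conjugated_form_bound[where \<beta> = \<beta> and v = v])
          (use A_sym A_le \<beta>_sym v \<beta>[OF J] in \<open>auto simp: a_def inner_commute\<close>)
      then show "\<phi> z \<le> 0"
        using A_lower[of z] by (simp add: \<phi>_def power2_norm_eq_inner left_diff_distrib)
    qed
    then show ?thesis by (simp add: \<phi>_def power2_norm_eq_inner)
  qed
  have "norm (exp ((- t) *\<^sub>R B)) \<le> exp (- t * (lam - \<kappa>))"
  proof (rule norm_endo_exp_le)
    show "inner (endo_apply ((- t) *\<^sub>R B) u) u \<le> - t * (lam - \<kappa>) * (norm u)\<^sup>2" for u
      using mult_left_mono[OF lower[of u] \<open>0 \<le> t\<close>] by (simp add: endo.scaleR_left endo.minus_left mult.assoc)
  qed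
  then have exp_B: "norm (endo_apply (exp ((- t) *\<^sub>R B)) u) \<le> exp (- t * (lam - \<kappa>)) * norm u" for u
    using norm_endo_apply[of "exp ((- t) *\<^sub>R B)" u] by (meson mult_right_mono norm_ge_zero order_trans)
  have conj: "exp ((- t) *\<^sub>R B) * D = D * exp ((- t) *\<^sub>R A)"
    using exp_conjugate[OF ED, of "(- t) *\<^sub>R A"] by (simp add: B_def)
  have Df: "endo_apply D f = f"
    using f by (force simp: Rep_ell2_inject[symmetric] fun_eq_iff D)
  have Eg: "norm (endo_apply E g) \<le> exp (- r) * norm g"
  proof (rule norm_ell2_leI)
    fix J :: "'a set" assume J: "finite J"
    have "(\<Sum>x\<in>J. (Rep_ell2 (endo_apply E g) x)\<^sup>2) \<le> (\<Sum>x\<in>J. (exp (- r))\<^sup>2 * (Rep_ell2 g x)\<^sup>2)"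
    proof (rule sum_mono)
      fix x
      show "(Rep_ell2 (endo_apply E g) x)\<^sup>2 \<le> (exp (- r))\<^sup>2 * (Rep_ell2 g x)\<^sup>2"
        using g[of x] unfolding E power_mult_distrib
        by (cases "Rep_ell2 g x = 0") (auto intro!: mult_right_mono power_mono)
    qed
    also have "\<dots> \<le> (exp (- r))\<^sup>2 * (norm g)\<^sup>2"
      unfolding sum_distrib_left[symmetric]
      by (intro mult_left_mono ell2_finite_sum_le J) simp
    finally show "(\<Sum>x\<in>J. (Rep_ell2 (endo_apply E g) x)\<^sup>2) \<le> (exp (- r) * norm g)\<^sup>2"
      by (simp add: power_mult_distrib)
  qed simp
  have "inner (endo_apply (exp ((- t) *\<^sub>R A)) f) g
      = inner (endo_apply (D * exp ((- t) *\<^sub>R A)) f) (endo_apply E g)"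
    using E_sym[of "endo_apply (D * exp ((- t) *\<^sub>R A)) f" g] endo_apply_times[of E D]
    by (simp add: ED)
  also have "\<dots> = inner (endo_apply (exp ((- t) *\<^sub>R B)) f) (endo_apply E g)"
    by (simp only: conj[symmetric] endo_apply_times Df)
  also have "\<bar>\<dots>\<bar> \<le> norm (endo_apply (exp ((- t) *\<^sub>R B)) f) * norm (endo_apply E g)"
    by (rule Cauchy_Schwarz_ineq2)
  also have "\<dots> \<le> (exp (- t * (lam - \<kappa>)) * norm f) * (exp (- r) * norm g)"
    by (intro mult_mono exp_B Eg) auto
  also have "\<dots> = exp (- lam * t + \<kappa> * t - r) * norm f * norm g"
    by (simp add: algebra_simps exp_diff exp_add exp_minus divide_inverse)
  finally show ?thesis .
qed

text \<open>(cosh x - 1) / x^2 increases on the positive axis. Since cosh x - 1 = 2 sinh(x / 2)^2,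
  this reduces to sinh being convex there with sinh 0 = 0.\<close>

lemma cosh_minus_one_le:
  fixes p q :: real
  assumes "0 \<le> p" "p \<le> q" "0 < q"
  shows "cosh p - 1 \<le> p\<^sup>2 / q\<^sup>2 * (cosh q - 1)"
proof -
  have "convex_on {0..} (sinh :: real \<Rightarrow> real)"
    by (rule convex_on_realI[where f' = cosh]) (auto intro!: derivative_eq_intros simp: cosh_real_nonneg_le_iff)
  then have "sinh ((1 - p / q) *\<^sub>R 0 + (p / q) *\<^sub>R (q / 2)) \<le> (1 - p / q) * sinh 0 + (p / q) * sinh (q / 2)"
    using assms by (intro convex_onD) auto
  then have "sinh (p / 2) \<le> p / q * sinh (q / 2)"
    using assms by simp
  then have "(sinh (p / 2))\<^sup>2 \<le> (p / q * sinh (q / 2))\<^sup>2"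
    using assms by (intro power_mono) auto
  moreover have half: "cosh x - 1 = 2 * (sinh (x / 2))\<^sup>2" for x :: real
    using cosh_double[of "x / 2"] by (simp add: cosh_square_eq)
  ultimately have "cosh p - 1 \<le> 2 * (p / q * sinh (q / 2))\<^sup>2" by simp
  then show ?thesis
    unfolding half[of q] by (simp add: power_mult_distrib power_divide mult.left_commute)
qed

section \<open>The exponentially weighted estimate on \<open>l2 X w\<close>\<close>

context weighted_set
begin

lemma l2_inner_scale: "l2_inner X w (\<lambda>x. a * f x) (\<lambda>x. b * g x) = a * b * l2_inner X w f g"
  unfolding l2_inner_def infsum_cmult_right'[symmetric] by (simp add: ac_simps)

lemma l2_exp_weighted_bound:
  assumes T: "l2_bounded_op X w X w T"
    and sym: "\<And>f g. f \<in> l2 X w \<Longrightarrow> g \<in> l2 X w \<Longrightarrow> l2_inner X w (T f) g = l2_inner X w f (T g)"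
    and lower: "\<And>f. f \<in> l2 X w \<Longrightarrow> lam * l2_inner X w f f \<le> l2_inner X w (T f) f"
    and \<omega>: "\<And>x. 0 \<le> \<omega> x" "\<And>x. \<omega> x \<le> M"
    and T_le: "\<And>x J. x \<in> X \<Longrightarrow> finite J \<Longrightarrow> J \<subseteq> X \<Longrightarrow>
      (\<Sum>y\<in>J. \<bar>l2_inner X w (T (point x)) (point y)\<bar> * (cosh (\<omega> x - \<omega> y) - 1)) \<le> \<kappa> * w x"
    and "0 \<le> \<kappa>" "0 \<le> t"
    and f: "f \<in> l2 X w" "\<And>x. f x \<noteq> 0 \<Longrightarrow> \<omega> x = 0"
    and g: "g \<in> l2 X w" "\<And>x. g x \<noteq> 0 \<Longrightarrow> r \<le> \<omega> x"
  shows "\<bar>l2_inner X w (l2_exp X w (\<lambda>f x. - t * T f x) f) g\<bar>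
    \<le> exp (- lam * t + \<kappa> * t - r) * l2_norm X w f * l2_norm X w g"
proof -
  \<comment> \<open>The scalar on the complement is \<open>lam\<close>, so that the lower bound for
    T extends to all of \<open>ell2\<close>.\<close>
  define A where "A = extension lam T"
  have A: "endo_apply A u = emb (T (res u)) + lam *\<^sub>R (u - emb (res u))" for u
    using extension_apply[OF T] by (simp add: A_def)
  have T_in: "T f \<in> l2 X w" if "f \<in> l2 X w" for f
    using T that by (simp add: l2_bounded_op_def)
  have inner_A: "inner (endo_apply A u) z
      = l2_inner X w (T (res u)) (res z) + lam * (inner u z - inner (emb (res u)) (emb (res z)))" for u z
    using inner_emb_left[of "T (res u)" z] inner_emb_left[of "res u" z]
    by (simp add: A inner_add_left inner_diff_left T_in flip: inner_emb_emb)
  \<comment> \<open>For x in X the basis vector corresponds to \<open>point x\<close> divided by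
    sqrt (w x), so normalised matrix entries carry the factor 1 / (v x v y). Off X the value 1 keeps
    v positive, and \<beta> is 0 there.\<close>
  define v where "v x = (if x \<in> X then sqrt (w x) else 1)" for x
  define \<beta> where "\<beta> x y = (if x \<in> X \<and> y \<in> X
    then \<bar>l2_inner X w (T (point x)) (point y)\<bar> else 0)" for x y
  have v: "0 < v x" for x using weight_pos by (simp add: v_def)
  have res_basis: "res (ell2_basis x)
      = (if x \<in> X then (\<lambda>y. 1 / sqrt (w x) * point x y) else (\<lambda>_. 0))" for x
    by (auto simp: fun_eq_iff l2_restrict_def point_def ell2_basis.rep_eq)
  have emb_res_basis: "emb (res (ell2_basis x)) = (if x \<in> X then ell2_basis x else 0)" for x
    by (auto simp: Rep_ell2_inject[symmetric] fun_eq_iff Rep_emb_res ell2_basis.rep_eq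
        zero_ell2.rep_eq)
  have T_zero: "T (\<lambda>_. 0) = (\<lambda>_. 0)"
  proof -
    have "T (\<lambda>x. 0 * res 0 x) = (\<lambda>x. 0 * T (res 0) x)"
      using T res_in_l2 unfolding l2_bounded_op_def by blast
    then show ?thesis by simp
  qed
  have rep: "represents ((- t) *\<^sub>R A) (\<lambda>f x. - t * T f x)"
    unfolding A_def by (rule represents_scale[OF represents_extension[OF T]])
  have "\<bar>inner (endo_apply (exp ((- t) *\<^sub>R A)) (emb f)) (emb g)\<bar>
      \<le> exp (- lam * t + \<kappa> * t - r) * norm (emb f) * norm (emb g)"
  proof (rule ell2_exp_weighted_bound[where \<beta> = \<beta> and v = v and \<omega> = \<omega> and M = M])
    show "inner (endo_apply A u) z = inner u (endo_apply A z)" for u z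
      unfolding A_def by (rule extension_symmetric[OF T sym])
    show "lam * (norm u)\<^sup>2 \<le> inner (endo_apply A u) u" for u
      using lower[of "res u"]
      by (simp add: inner_A power2_norm_eq_inner right_diff_distrib inner_emb_emb)
    show "\<beta> x y = \<beta> y x" for x y
      using sym[of "point x" "point y"] by (auto simp: \<beta>_def point_in_l2 l2_inner_commute)
    show "\<bar>inner (endo_apply A (ell2_basis x)) (ell2_basis y)\<bar> \<le> \<beta> x y / (v x * v y)"
      if "x \<noteq> y" for x y
    proof -
      have "inner (endo_apply A (ell2_basis x)) (ell2_basis y)
          = l2_inner X w (T (res (ell2_basis x))) (res (ell2_basis y))"
        using that by (simp add: inner_A emb_res_basis inner_ell2_basis ell2_basis.rep_eq)
      also have "\<bar>\<dots>\<bar> = \<beta> x y / (v x * v y)"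
      proof (cases "x \<in> X \<and> y \<in> X")
        case True
        then have "l2_inner X w (T (res (ell2_basis x))) (res (ell2_basis y))
            = 1 / sqrt (w x) * (1 / sqrt (w y)) * l2_inner X w (T (point x)) (point y)"
          using T by (simp only: res_basis if_True l2_bounded_op_def l2_inner_scale point_in_l2)
        then show ?thesis using True by (simp add: \<beta>_def v_def abs_mult)
      next
        case False
        then show ?thesis by (auto simp: res_basis T_zero \<beta>_def l2_inner_def)
      qed
      finally show ?thesis by simp
    qed
    show "(\<Sum>y\<in>J. \<beta> x y * (cosh (\<omega> x - \<omega> y) - 1)) \<le> \<kappa> * (v x)\<^sup>2" if "finite J" for x J
    proof (cases "x \<in> X")
      case True
      have "(\<Sum>y\<in>J. \<beta> x y * (cosh (\<omega> x - \<omega> y) - 1))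
          = (\<Sum>y\<in>J \<inter> X. \<beta> x y * (cosh (\<omega> x - \<omega> y) - 1))"
        using that by (intro sum.mono_neutral_right) (auto simp: \<beta>_def)
      also have "\<dots> = (\<Sum>y\<in>J \<inter> X.
          \<bar>l2_inner X w (T (point x)) (point y)\<bar> * (cosh (\<omega> x - \<omega> y) - 1))"
        using True by (intro sum.cong) (auto simp: \<beta>_def)
      also have "\<dots> \<le> \<kappa> * w x" using that True by (intro T_le) auto
      finally show ?thesis using True by (simp add: v_def)
    qed (use \<open>0 \<le> \<kappa>\<close> in \<open>simp add: \<beta>_def v_def\<close>)
  qed (use v \<omega> f g \<open>0 \<le> t\<close> in \<open>auto simp: Rep_emb split: if_splits\<close>)
  then show ?thesis
    using represents_exp[OF rep f(1)] f(1) g(1)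
    by (simp add: norm_emb flip: inner_emb_emb)
qed

lemma l2_exp_symmetric:
  assumes T: "l2_bounded_op X w X w T"
    and sym: "\<And>f g. f \<in> l2 X w \<Longrightarrow> g \<in> l2 X w \<Longrightarrow> l2_inner X w (T f) g = l2_inner X w f (T g)"
    and fg: "f \<in> l2 X w" "g \<in> l2 X w"
  shows "l2_inner X w (l2_exp X w (\<lambda>f x. c * T f x) f) g
    = l2_inner X w f (l2_exp X w (\<lambda>f x. c * T f x) g)"
proof -
  define A where "A = extension 0 T"
  have A_sym: "inner (endo_apply A u) v = inner u (endo_apply A v)" for u v
    unfolding A_def by (rule extension_symmetric[OF T sym])
  have rep: "represents (c *\<^sub>R A) (\<lambda>f x. c * T f x)"
    unfolding A_def by (rule represents_scale[OF represents_extension[OF T]])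
  have "inner (endo_apply (exp (c *\<^sub>R A)) (emb f)) (emb g)
      = inner (emb f) (endo_apply (exp (c *\<^sub>R A)) (emb g))"
    by (rule endo_exp_symmetric) (simp add: endo.scaleR_left A_sym)
  then show ?thesis
    using represents_exp[OF rep fg(1)] represents_exp[OF rep fg(2)] fg
    by (simp flip: inner_emb_emb)
qed

end

section \<open>Truncated distances and the optimal exponent\<close>

lemma abs_enn2real_diff_le:
  assumes "a \<le> b + c" "b \<le> a + c" "a \<noteq> top" "b \<noteq> top" "c \<noteq> top"
  shows "\<bar>enn2real a - enn2real b\<bar> \<le> enn2real c"
proof -
  have "enn2real a \<le> enn2real (b + c)" "enn2real b \<le> enn2real (a + c)"
    using assms by (auto intro!: enn2real_mono simp: less_top)
  then show ?thesis
    using assms by (simp add: enn2real_plus less_top abs_le_iff)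
qed

text \<open>The distance to a set is 1-Lipschitz, and truncation preserves this. Subtracting \<rho>
  x y on the left leaves a bare infimum on the right, which can be bounded from below point by
  point.\<close>

lemma truncated_distance_le:
  fixes \<rho> :: "'a \<Rightarrow> 'a \<Rightarrow> ennreal"
  assumes \<rho>: "pseudo_metric_on X \<rho>" and "A \<subseteq> X" "x \<in> X" "y \<in> X"
  shows "min M (INF a\<in>A. \<rho> a y) \<le> min M (INF a\<in>A. \<rho> a x) + \<rho> x y"
proof (cases "\<rho> x y = top")
  case False
  have "(INF a\<in>A. \<rho> a y) - \<rho> x y \<le> (INF a\<in>A. \<rho> a x)"
  proof (rule INF_greatest)
    fix a assume a: "a \<in> A"
    have "(INF a\<in>A. \<rho> a y) \<le> \<rho> a y" using a by (rule INF_lower)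
    also have "\<dots> \<le> \<rho> a x + \<rho> x y"
      using \<rho> a assms unfolding pseudo_metric_on_def by blast
    finally show "(INF a\<in>A. \<rho> a y) - \<rho> x y \<le> \<rho> a x"
      using False by (simp add: ennreal_minus_le_iff add.commute)
  qed
  then have "(INF a\<in>A. \<rho> a y) \<le> (INF a\<in>A. \<rho> a x) + \<rho> x y"
    by (simp add: ennreal_minus_le_iff add.commute)
  then show ?thesis
    by (auto simp: min_def add_increasing2 intro: order_trans)
qed simp

text \<open>The exponent (cosh (\<alpha> s) - 1) t / s^2 - \<alpha> r is stationary in \<alpha>
  where sinh (\<alpha> s) = r s / t. The value there is -\<zeta>, which is where
  \<open>zeta_fun\<close> originates.\<close>

lemma cosh_arsinh_optimum:
  fixes s t r :: real
  assumes "0 < s" "0 < t"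
  shows "(cosh (arsinh (r * s / t)) - 1) / s\<^sup>2 * t - arsinh (r * s / t) / s * r
    = - (1 / s\<^sup>2 * (r * s * arsinh (r * s / t) - sqrt (t\<^sup>2 + r\<^sup>2 * s\<^sup>2) + t))"
proof -
  have "sqrt (t\<^sup>2 + r\<^sup>2 * s\<^sup>2) = sqrt (((r * s / t)\<^sup>2 + 1) * t\<^sup>2)"
    using assms by (simp add: field_simps)
  also have "\<dots> = sqrt ((r * s / t)\<^sup>2 + 1) * t"
    unfolding real_sqrt_mult using assms by simp
  finally show ?thesis
    using assms by (simp add: cosh_arsinh_real field_simps power2_eq_square)
qed

context weighted_set
begin

text \<open>M is any real level up to the distance, and \<alpha> is free; both are chosen
  afterwards, so that finite and infinite distances share this estimate. The weights b play a double
  part, as bounds on the matrix entries and in the intrinsic condition.\<close>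

lemma l2_exp_distance_bound:
  fixes \<rho> :: "'a \<Rightarrow> 'a \<Rightarrow> ennreal" and b :: "'a \<Rightarrow> 'a \<Rightarrow> real"
  assumes T: "l2_bounded_op X w X w T"
    and sym: "\<And>f g. f \<in> l2 X w \<Longrightarrow> g \<in> l2 X w \<Longrightarrow> l2_inner X w (T f) g = l2_inner X w f (T g)"
    and lower: "\<And>f. f \<in> l2 X w \<Longrightarrow> lam * l2_inner X w f f \<le> l2_inner X w (T f) f"
    and T_le: "\<And>x y. x \<in> X \<Longrightarrow> y \<in> X \<Longrightarrow> x \<noteq> y \<Longrightarrow>
      \<bar>l2_inner X w (T (point x)) (point y)\<bar> \<le> b x y"
    and \<rho>: "pseudo_metric_on X \<rho>"
    and intrinsic: "\<And>x. x \<in> X \<Longrightarrow> (\<Sum>\<^sub>\<infinity>y\<in>X. ennreal (b x y) * (\<rho> x y)\<^sup>2) \<le> ennreal (w x)"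
    and jump: "\<And>x y. x \<in> X \<Longrightarrow> y \<in> X \<Longrightarrow> b x y \<noteq> 0 \<Longrightarrow> \<rho> x y \<le> ennreal s"
    and "0 < s" "0 \<le> t" "0 \<le> \<alpha>" "0 \<le> M"
    and AB: "A \<subseteq> X" "B \<subseteq> X" "ennreal M \<le> set_distance \<rho> A B"
    and f: "f \<in> l2 X w" "support_on X f \<subseteq> A"
    and g: "g \<in> l2 X w" "support_on X g \<subseteq> B"
  shows "\<bar>l2_inner X w (l2_exp X w (\<lambda>f x. - t * T f x) f) g\<bar>
    \<le> exp (- lam * t + (cosh (\<alpha> * s) - 1) / s\<^sup>2 * t - \<alpha> * M) * l2_norm X w f * l2_norm X w g"
proof (cases "\<alpha> = 0")
  \<comment> \<open>Treated apart because the comparison of cosh values divides by (\<alpha> s)^2;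
    without a weight the form does not change.\<close>
  case True
  have "\<bar>l2_inner X w (l2_exp X w (\<lambda>f x. - t * T f x) f) g\<bar>
    \<le> exp (- lam * t + 0 * t - 0) * l2_norm X w f * l2_norm X w g"
    by (rule l2_exp_weighted_bound[where \<omega> = "\<lambda>_. 0" and M = 0])
      (use assms in auto)
  then show ?thesis using True by simp
next
  case False
  then have "0 < \<alpha>" using \<open>0 \<le> \<alpha>\<close> by simp
  define d where "d x = min (ennreal M) (INF a\<in>A. \<rho> a x)" for x
  define \<omega> where "\<omega> x = \<alpha> * enn2real (d x)" for x
  define \<kappa> where "\<kappa> = (cosh (\<alpha> * s) - 1) / s\<^sup>2"
  have "0 \<le> \<kappa>" by (simp add: \<kappa>_def cosh_real_ge_1)
  have d_top: "d x \<noteq> top" for x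
    using min.cobounded1[of "ennreal M"] unfolding d_def by (rule neq_top_trans[rotated]) simp
  have d_le: "enn2real (d x) \<le> M" for x
    using \<open>0 \<le> M\<close> by (intro enn2real_leI) (auto simp: d_def)
  have d_lip: "\<bar>enn2real (d x) - enn2real (d y)\<bar> \<le> enn2real (\<rho> x y)"
    if "x \<in> X" "y \<in> X" "\<rho> x y \<noteq> top" for x y
  proof -
    have "\<rho> x y = \<rho> y x" using \<rho> that unfolding pseudo_metric_on_def by blast
    then show ?thesis
      using truncated_distance_le[OF \<rho> AB(1) that(1,2), of "ennreal M"]
        truncated_distance_le[OF \<rho> AB(1) that(2,1), of "ennreal M"] that(3)
      by (intro abs_enn2real_diff_le) (auto simp: d_top simp flip: d_def)
  qed
  have term_le: "\<bar>l2_inner X w (T (point x)) (point y)\<bar> * (cosh (\<omega> x - \<omega> y) - 1)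
      \<le> \<kappa> * (b x y * (enn2real (\<rho> x y))\<^sup>2)" if "x \<in> X" "y \<in> X" "x \<noteq> y" for x y
  \<comment> \<open>If b x y = 0 the jump bound is silent and \<rho> x y may be infinite, but then
    the matrix entry vanishes.\<close>
  proof (cases "b x y = 0")
    case True
    then show ?thesis using T_le[OF that] by simp
  next
    case False
    have "0 \<le> b x y" using T_le[OF that] abs_ge_zero order_trans by blast
    define p where "p = \<alpha> * enn2real (\<rho> x y)"
    have \<rho>_le: "\<rho> x y \<le> ennreal s" using jump that False by blast
    then have "\<rho> x y \<noteq> top" by (auto simp: top_unique)
    have "\<bar>\<omega> x - \<omega> y\<bar> = \<alpha> * \<bar>enn2real (d x) - enn2real (d y)\<bar>"
      using \<open>0 < \<alpha>\<close> by (simp add: \<omega>_def abs_mult flip: right_diff_distrib)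
    also have "\<dots> \<le> p"
      unfolding p_def using d_lip[OF that(1,2) \<open>\<rho> x y \<noteq> top\<close>] \<open>0 < \<alpha>\<close> by (intro mult_left_mono) auto
    finally have "cosh (\<omega> x - \<omega> y) \<le> cosh p"
      using cosh_real_nonneg_le_iff[of "\<bar>\<omega> x - \<omega> y\<bar>" p] by simp
    moreover have "cosh p - 1 \<le> p\<^sup>2 / (\<alpha> * s)\<^sup>2 * (cosh (\<alpha> * s) - 1)"
      using \<rho>_le \<open>0 < \<alpha>\<close> \<open>0 < s\<close>
      by (intro cosh_minus_one_le) (auto simp: p_def intro!: mult_left_mono enn2real_leI)
    moreover have "p\<^sup>2 / (\<alpha> * s)\<^sup>2 * (cosh (\<alpha> * s) - 1) = \<kappa> * (enn2real (\<rho> x y))\<^sup>2"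
      using \<open>0 < \<alpha>\<close> by (simp add: p_def \<kappa>_def power_mult_distrib)
    ultimately have "cosh (\<omega> x - \<omega> y) - 1 \<le> \<kappa> * (enn2real (\<rho> x y))\<^sup>2" by linarith
    then have "\<bar>l2_inner X w (T (point x)) (point y)\<bar> * (cosh (\<omega> x - \<omega> y) - 1)
        \<le> b x y * (\<kappa> * (enn2real (\<rho> x y))\<^sup>2)"
      using T_le[OF that] \<open>0 \<le> b x y\<close> by (intro mult_mono) (auto simp: cosh_real_ge_1)
    then show ?thesis by (simp add: ac_simps)
  qed
  have sum_le: "(\<Sum>y\<in>J. b x y * (enn2real (\<rho> x y))\<^sup>2) \<le> w x"
    if "x \<in> X" "finite J" "J \<subseteq> X - {x}" for x J
  proof -
    have b_nonneg: "0 \<le> b x y" if "y \<in> J" for y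
      using T_le[of x y] abs_ge_zero order_trans that \<open>x \<in> X\<close> \<open>J \<subseteq> X - {x}\<close> by blast
    \<comment> \<open>\<open>enn2real\<close> sends infinity to 0. This is harmless: \<rho> is
      finite where b is nonzero, and elsewhere both products are 0.\<close>
    have "ennreal (b x y * (enn2real (\<rho> x y))\<^sup>2) = ennreal (b x y) * (\<rho> x y)\<^sup>2" if "y \<in> J" for y
    proof (cases "b x y = 0")
      case False
      then have "\<rho> x y \<noteq> top"
        using jump[of x y] that \<open>x \<in> X\<close> \<open>J \<subseteq> X - {x}\<close> by (auto simp: top_unique)
      then obtain c where "0 \<le> c" "\<rho> x y = ennreal c" by (cases "\<rho> x y") auto
      then show ?thesis
        using b_nonneg[OF that] by (simp add: ennreal_mult' ennreal_power)
    qed simp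
    then have "ennreal (\<Sum>y\<in>J. b x y * (enn2real (\<rho> x y))\<^sup>2)
        = (\<Sum>y\<in>J. ennreal (b x y) * (\<rho> x y)\<^sup>2)"
      using b_nonneg by (simp add: sum_ennreal[symmetric] del: sum_ennreal)
    also have "\<dots> = (\<Sum>\<^sub>\<infinity>y\<in>J. ennreal (b x y) * (\<rho> x y)\<^sup>2)"
      using that(2) by simp
    also have "\<dots> \<le> (\<Sum>\<^sub>\<infinity>y\<in>X. ennreal (b x y) * (\<rho> x y)\<^sup>2)"
      using that by (intro infsum_mono_neutral nonneg_summable_on_complete) auto
    also have "\<dots> \<le> ennreal (w x)" using intrinsic that(1) .
    finally show ?thesis using that(1) by simp
  qed
  have "\<bar>l2_inner X w (l2_exp X w (\<lambda>f x. - t * T f x) f) g\<bar>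
    \<le> exp (- lam * t + \<kappa> * t - \<alpha> * M) * l2_norm X w f * l2_norm X w g"
  proof (rule l2_exp_weighted_bound[where \<omega> = \<omega> and M = "\<alpha> * M"])
    show "0 \<le> \<omega> x" "\<omega> x \<le> \<alpha> * M" for x
      using \<open>0 < \<alpha>\<close> d_le[of x] by (auto simp: \<omega>_def)
    show "(\<Sum>y\<in>J. \<bar>l2_inner X w (T (point x)) (point y)\<bar> * (cosh (\<omega> x - \<omega> y) - 1)) \<le> \<kappa> * w x"
      if "x \<in> X" "finite J" "J \<subseteq> X" for x J
    proof -
      have "(\<Sum>y\<in>J. \<bar>l2_inner X w (T (point x)) (point y)\<bar> * (cosh (\<omega> x - \<omega> y) - 1))
          = (\<Sum>y\<in>J - {x}. \<bar>l2_inner X w (T (point x)) (point y)\<bar> * (cosh (\<omega> x - \<omega> y) - 1))"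
        using that by (intro sum.mono_neutral_right) auto
      also have "\<dots> \<le> (\<Sum>y\<in>J - {x}. \<kappa> * (b x y * (enn2real (\<rho> x y))\<^sup>2))"
        using that by (intro sum_mono term_le) auto
      also have "\<dots> \<le> \<kappa> * w x"
        unfolding sum_distrib_left[symmetric]
        using that \<open>0 \<le> \<kappa>\<close> by (intro mult_left_mono sum_le) auto
      finally show ?thesis .
    qed
    show "\<omega> x = 0" if "f x \<noteq> 0" for x
    proof -
      have "x \<in> X" "x \<in> A"
        using that f l2_outside[OF f(1), of x] by (auto simp: support_on_def)
      then have "(INF a\<in>A. \<rho> a x) \<le> 0"
        using \<rho> INF_lower[of x A "\<lambda>a. \<rho> a x"] by (simp add: pseudo_metric_on_def)
      then show ?thesis by (simp add: \<omega>_def d_def min_def)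
    qed
    show "\<alpha> * M \<le> \<omega> y" if "g y \<noteq> 0" for y
    proof -
      have "y \<in> B"
        using that g l2_outside[OF g(1), of y] by (auto simp: support_on_def)
      have "ennreal M \<le> (INF a\<in>A. \<rho> a y)"
      proof (rule INF_greatest)
        fix a assume "a \<in> A"
        have "set_distance \<rho> A B \<le> (INF y\<in>B. \<rho> a y)"
          unfolding set_distance_def using \<open>a \<in> A\<close> by (rule INF_lower)
        also have "\<dots> \<le> \<rho> a y" using \<open>y \<in> B\<close> by (rule INF_lower)
        finally show "ennreal M \<le> \<rho> a y" using AB(3) by (rule order_trans[rotated])
      qed
      then have "d y = ennreal M" by (simp add: d_def min_absorb1)
      then show ?thesis using \<open>0 \<le> M\<close> by (simp add: \<omega>_def)
    qed
  qed (use assms \<open>0 \<le> \<kappa>\<close> in auto)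
  then show ?thesis by (simp add: \<kappa>_def)
qed

lemma l2_exp_davies_gaffney:
  fixes \<rho> :: "'a \<Rightarrow> 'a \<Rightarrow> ennreal" and b :: "'a \<Rightarrow> 'a \<Rightarrow> real"
  assumes T: "l2_bounded_op X w X w T"
    and sym: "\<And>f g. f \<in> l2 X w \<Longrightarrow> g \<in> l2 X w \<Longrightarrow> l2_inner X w (T f) g = l2_inner X w f (T g)"
    and T_le: "\<And>x y. x \<in> X \<Longrightarrow> y \<in> X \<Longrightarrow> x \<noteq> y \<Longrightarrow>
      \<bar>l2_inner X w (T (point x)) (point y)\<bar> \<le> b x y"
    and \<rho>: "pseudo_metric_on X \<rho>"
    and intrinsic: "\<And>x. x \<in> X \<Longrightarrow> (\<Sum>\<^sub>\<infinity>y\<in>X. ennreal (b x y) * (\<rho> x y)\<^sup>2) \<le> ennreal (w x)"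
    and jump: "\<And>x y. x \<in> X \<Longrightarrow> y \<in> X \<Longrightarrow> b x y \<noteq> 0 \<Longrightarrow> \<rho> x y \<le> ennreal s"
    and "0 < s" "0 < t"
    and AB: "A \<subseteq> X" "B \<subseteq> X"
    and f: "f \<in> l2 X w" "support_on X f \<subseteq> A"
    and g: "g \<in> l2 X w" "support_on X g \<subseteq> B"
  shows "\<bar>l2_inner X w (l2_exp X w (\<lambda>f x. - t * T f x) f) g\<bar>
    \<le> exp_ereal (ereal (- l2_spectrum_bottom X w T * t) - zeta_fun s t (set_distance \<rho> A B))
      * l2_norm X w f * l2_norm X w g" (is "\<bar>?I\<bar> \<le> _")
proof -
  define lam where "lam = l2_spectrum_bottom X w T"
  define N where "N = l2_norm X w f * l2_norm X w g"
  have "0 \<le> N" using f g by (simp add: N_def flip: norm_emb)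
  have bound: "\<bar>?I\<bar> \<le> exp (- lam * t + (cosh (\<alpha> * s) - 1) / s\<^sup>2 * t - \<alpha> * M) * N"
    if "0 \<le> \<alpha>" "0 \<le> M" "ennreal M \<le> set_distance \<rho> A B" for \<alpha> M
    using l2_exp_distance_bound[OF T sym _ T_le \<rho> intrinsic jump \<open>0 < s\<close> less_imp_le[OF \<open>0 < t\<close>]
        that(1,2) AB that(3) f g, of lam] spectrum_bottom_le_quadratic_form[OF T sym]
    by (simp add: N_def lam_def mult.assoc)
  have "\<bar>?I\<bar> \<le> exp_ereal (ereal (- lam * t) - zeta_fun s t (set_distance \<rho> A B)) * N"
  proof (cases "set_distance \<rho> A B = top")
    case True
    \<comment> \<open>Every M is admissible here, and \<alpha> = 1 is an arbitrary positive choice.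
      The pairing is forced to be 0, in agreement with the value of \<open>exp_ereal\<close> at
      minus infinity. Empty A or B falls under this case.\<close>
    have lim: "((\<lambda>M. exp (- lam * t + (cosh (1 * s) - 1) / s\<^sup>2 * t - 1 * M) * N) \<longlongrightarrow> 0) at_top"
    proof -
      have "((\<lambda>M. exp (- lam * t + (cosh (1 * s) - 1) / s\<^sup>2 * t) * N * exp (- M)) \<longlongrightarrow>
          exp (- lam * t + (cosh (1 * s) - 1) / s\<^sup>2 * t) * N * 0) at_top"
        by (intro tendsto_intros filterlim_compose[OF exp_at_bot] filterlim_uminus_at_bot_at_top)
      moreover have "exp (c - 1 * M) * N = exp c * N * exp (- M)" for c M
        by (simp add: exp_diff exp_minus field_simps)
      ultimately show ?thesis by (simp only: mult_zero_right)
    qed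
    have "\<bar>?I\<bar> \<le> 0"
      by (rule tendsto_lowerbound[OF lim])
        (use bound[of 1] True in \<open>auto intro!: eventually_at_top_linorderI[of 0]\<close>)
    then show ?thesis
      using True \<open>0 \<le> N\<close> by (simp add: zeta_fun_def exp_ereal_def infinity_ennreal_def)
  next
    case False
    define r where "r = enn2real (set_distance \<rho> A B)"
    have r: "0 \<le> r" "ennreal r = set_distance \<rho> A B"
      using False by (simp_all add: r_def less_top)
    define \<alpha> where "\<alpha> = arsinh (r * s / t) / s"
    have "0 \<le> r * s / t" using r(1) \<open>0 < s\<close> \<open>0 < t\<close> by simp
    then have "\<not> arsinh (r * s / t) < arsinh 0"
      unfolding arsinh_less_iff_real by (simp only: not_less)
    then have "0 \<le> arsinh (r * s / t)" by (simp only: not_less arsinh_0)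
    then have "0 \<le> \<alpha>" using \<open>0 < s\<close> by (simp add: \<alpha>_def)
    have "\<alpha> * s = arsinh (r * s / t)" using \<open>0 < s\<close> by (simp add: \<alpha>_def)
    then have "- lam * t + (cosh (\<alpha> * s) - 1) / s\<^sup>2 * t - \<alpha> * r
        = - lam * t - 1 / s\<^sup>2 * (r * s * arsinh (r * s / t) - sqrt (t\<^sup>2 + r\<^sup>2 * s\<^sup>2) + t)"
      using cosh_arsinh_optimum[OF \<open>0 < s\<close> \<open>0 < t\<close>, of r] by (simp add: \<alpha>_def)
    moreover have "zeta_fun s t (set_distance \<rho> A B)
        = ereal (1 / s\<^sup>2 * (r * s * arsinh (r * s / t) - sqrt (t\<^sup>2 + r\<^sup>2 * s\<^sup>2) + t))"
      using False by (simp add: zeta_fun_def r_def Let_def)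
    moreover have "\<bar>?I\<bar> \<le> exp (- lam * t + (cosh (\<alpha> * s) - 1) / s\<^sup>2 * t - \<alpha> * r) * N"
      by (rule bound[OF \<open>0 \<le> \<alpha>\<close> r(1)]) (simp add: r(2))
    ultimately show ?thesis by (simp only: exp_ereal_def) simp
  qed
  then show ?thesis by (simp add: lam_def N_def mult.assoc)
qed

end

section \<open>The Hodge Laplacian\<close>

lemma l2_bounded_op_compose:
  assumes "weighted_set X w" "weighted_set Y v" "weighted_set Z u"
    and "l2_bounded_op X w Y v T" "l2_bounded_op Y v Z u S"
  shows "l2_bounded_op X w Z u (\<lambda>f. S (T f))"
proof (rule l2_bounded_opI[OF assms(1,3)])
  interpret X: weighted_set X w by fact
  interpret Y: weighted_set Y v by fact
  interpret Z: weighted_set Z u by fact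
  show "bounded_linear (\<lambda>h. Z.emb (S (Y.res (Y.emb (T (X.res h))))))"
    using l2_bounded_op_bounded_linear[OF assms(1,2,4)] l2_bounded_op_bounded_linear[OF assms(2,3,5)]
    by (rule bounded_linear_compose[rotated])
  show "S (T f) = Z.res (Z.emb (S (Y.res (Y.emb (T (X.res (X.emb f)))))))" if "f \<in> l2 X w" for f
    using assms(4,5) that by (simp add: l2_bounded_op_def)
qed

lemma l2_bounded_op_add:
  assumes "weighted_set X w" "weighted_set Y v"
    and "l2_bounded_op X w Y v T" "l2_bounded_op X w Y v S"
  shows "l2_bounded_op X w Y v (\<lambda>f y. T f y + S f y)"
proof (rule l2_bounded_opI[OF assms(1,2)])
  interpret X: weighted_set X w by fact
  interpret Y: weighted_set Y v by fact
  show "bounded_linear (\<lambda>u. Y.emb (T (X.res u)) + Y.emb (S (X.res u)))"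
    by (intro bounded_linear_add l2_bounded_op_bounded_linear assms)
  show "(\<lambda>y. T f y + S f y) = Y.res (Y.emb (T (X.res (X.emb f))) + Y.emb (S (X.res (X.emb f))))"
    if "f \<in> l2 X w" for f
    using assms(3,4) that by (simp add: l2_bounded_op_def Y.res_add)
qed

section \<open>Incidence signs and neighbouring faces\<close>

lemma abs_incidence_sign_le: "\<bar>incidence_sign ori F G\<bar> \<le> 1"
  by (simp add: incidence_sign_def Let_def abs_mult power_abs)

lemma incidence_sign_nonzero: "incidence_sign ori F G \<noteq> 0 \<Longrightarrow> F \<in> face_boundary G"
  by (auto simp: incidence_sign_def split: if_splits)

lemma abs_sign_product_le:
  "\<bar>incidence_sign ori F G * incidence_sign ori F' G' * c\<bar> \<le> \<bar>c\<bar>"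
proof -
  have "\<bar>incidence_sign ori F G\<bar> * \<bar>incidence_sign ori F' G'\<bar> \<le> 1 * 1"
    by (intro mult_mono abs_incidence_sign_le) auto
  then show ?thesis
    unfolding abs_mult by (intro mult_left_le_one_le) auto
qed

text \<open>The union is strictly larger than F and lies in G, which has just one more vertex than
  F. So distinct faces share at most one coface, and sums over common cofaces collapse to one
  term.\<close>

lemma union_of_boundary_faces:
  assumes "finite G" "F \<in> face_boundary G" "F' \<in> face_boundary G" "F \<noteq> F'"
  shows "G = F \<union> F'"
proof -
  have F: "F \<subseteq> G" "F' \<subseteq> G" "card F + 1 = card G" "card F' + 1 = card G"
    using assms by (auto simp: face_boundary_def)
  then have "finite F" "finite F'" using assms(1) finite_subset by blast+
  then have "F \<subset> F \<union> F'"
    using F assms(4) card_subset_eq[of F F'] by auto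
  then have "card F < card (F \<union> F')"
    using \<open>finite F\<close> \<open>finite F'\<close> by (intro psubset_card_mono) auto
  then show ?thesis
    using F assms(1) by (intro card_seteq[symmetric]) auto
qed

text \<open>The dual fact for common facets: the intersection contains E and is a proper subset of
  F, which has just one more vertex than E.\<close>

lemma intersection_of_cofaces:
  assumes "finite F" "finite F'" "E \<in> face_boundary F" "E \<in> face_boundary F'" "F \<noteq> F'"
  shows "E = F \<inter> F'"
proof -
  have E: "E \<subseteq> F" "E \<subseteq> F'" "card E + 1 = card F" "card E + 1 = card F'"
    using assms by (auto simp: face_boundary_def)
  have "F \<inter> F' \<subset> F"
    using E assms card_subset_eq[of F' F] by auto
  then have "card (F \<inter> F') < card F"
    using assms(1) by (intro psubset_card_mono)
  then show ?thesis
    using E assms(1) by (intro card_seteq) auto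
qed

lemma infsum_single:
  fixes \<phi> :: "'a \<Rightarrow> real"
  assumes "\<And>y. y \<in> Y \<Longrightarrow> \<phi> y \<noteq> 0 \<Longrightarrow> y = x"
  shows "infsum \<phi> Y = (if x \<in> Y then \<phi> x else 0)"
proof (cases "x \<in> Y")
  case True
  then have "infsum \<phi> Y = infsum \<phi> {x}"
    using assms by (intro infsum_cong_neutral) auto
  then show ?thesis using True by simp
next
  case False
  then have "infsum \<phi> Y = infsum (\<lambda>_. 0) Y"
    using assms by (intro infsum_cong) auto
  then show ?thesis using False by simp
qed

section \<open>Quadratic form and matrix entries of the Laplacian\<close>

locale bounded_hodge =
  fixes V :: "'v set" and K :: "'v set set" and w :: "'v set \<Rightarrow> real"
    and ori :: "'v set \<Rightarrow> 'v list set" and i :: int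
  assumes complex: "abstract_simplicial_complex V K"
    and weighted: "weighted_complex K w"
    and bounded: "hodge_laplacian_bounded K w ori i"
begin

abbreviation "\<delta> \<equiv> coboundary K ori"
abbreviation "\<delta>\<^sub>a \<equiv> coboundary_adjoint K w ori"
abbreviation "L \<equiv> hodge_laplacian K w ori i"

lemma weighted_faces: "weighted_set (faces K j) w"
  using weighted by unfold_locales (auto simp: weighted_complex_def faces_def)

sublocale lower: weighted_set "faces K (i - 1)" w by (rule weighted_faces)
sublocale faces: weighted_set "faces K i" w by (rule weighted_faces)
sublocale upper: weighted_set "faces K (i + 1)" w by (rule weighted_faces)

lemma finite_face: "F \<in> faces K j \<Longrightarrow> finite F"
  using complex by (auto simp: abstract_simplicial_complex_def faces_def)

lemma coboundary_bounded:
  shows up: "l2_bounded_op (faces K i) w (faces K (i + 1)) w (\<delta> i)"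
    and down: "l2_bounded_op (faces K (i - 1)) w (faces K i) w (\<delta> (i - 1))"
  using bounded by (auto simp: hodge_laplacian_bounded_def)

lemma up_adjoint: "l2_bounded_op (faces K (i + 1)) w (faces K i) w (\<delta>\<^sub>a i)"
  unfolding coboundary_adjoint_def by (intro l2_bounded_op_adjoint weighted_faces up)

lemma down_adjoint: "l2_bounded_op (faces K i) w (faces K (i - 1)) w (\<delta>\<^sub>a (i - 1))"
  using l2_bounded_op_adjoint[OF weighted_faces weighted_faces down]
  by (simp add: coboundary_adjoint_def)

lemma inner_up_adjoint:
  "f \<in> l2 (faces K i) w \<Longrightarrow> g \<in> l2 (faces K (i + 1)) w \<Longrightarrow>
    l2_inner (faces K i) w f (\<delta>\<^sub>a i g) = l2_inner (faces K (i + 1)) w (\<delta> i f) g"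
  using l2_inner_adjoint[OF weighted_faces weighted_faces up]
  by (simp add: coboundary_adjoint_def)

lemma inner_down_adjoint:
  "f \<in> l2 (faces K (i - 1)) w \<Longrightarrow> g \<in> l2 (faces K i) w \<Longrightarrow>
    l2_inner (faces K (i - 1)) w f (\<delta>\<^sub>a (i - 1) g) = l2_inner (faces K i) w (\<delta> (i - 1) f) g"
  using l2_inner_adjoint[OF weighted_faces weighted_faces down]
  by (simp add: coboundary_adjoint_def)

lemma laplacian_bounded_op: "l2_bounded_op (faces K i) w (faces K i) w L"
proof -
  have "l2_bounded_op (faces K i) w (faces K i) w
      (\<lambda>f F. \<delta>\<^sub>a i (\<delta> i f) F + \<delta> (i - 1) (\<delta>\<^sub>a (i - 1) f) F)"
    by (intro l2_bounded_op_add weighted_faces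
        l2_bounded_op_compose[OF weighted_faces weighted_faces weighted_faces up up_adjoint]
        l2_bounded_op_compose[OF weighted_faces weighted_faces weighted_faces down_adjoint down])
  then show ?thesis by (simp add: hodge_laplacian_def[abs_def])
qed

text \<open>In this form symmetry is evident, and the matrix entries require explicit values of an
  adjoint only for the lower coboundary, on point functions.\<close>

lemma inner_laplacian:
  assumes f: "f \<in> l2 (faces K i) w" and g: "g \<in> l2 (faces K i) w"
  shows "l2_inner (faces K i) w (L f) g = l2_inner (faces K (i + 1)) w (\<delta> i f) (\<delta> i g)
    + l2_inner (faces K (i - 1)) w (\<delta>\<^sub>a (i - 1) f) (\<delta>\<^sub>a (i - 1) g)"
proof -
  have mem: "\<delta> i f \<in> l2 (faces K (i + 1)) w" "\<delta>\<^sub>a (i - 1) f \<in> l2 (faces K (i - 1)) w"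
    using f up down_adjoint by (auto simp: l2_bounded_op_def)
  have mem': "\<delta>\<^sub>a i (\<delta> i f) \<in> l2 (faces K i) w" "\<delta> (i - 1) (\<delta>\<^sub>a (i - 1) f) \<in> l2 (faces K i) w"
    using mem up_adjoint down by (auto simp: l2_bounded_op_def)
  have "l2_inner (faces K i) w (L f) g = l2_inner (faces K i) w (\<delta>\<^sub>a i (\<delta> i f)) g
      + l2_inner (faces K i) w (\<delta> (i - 1) (\<delta>\<^sub>a (i - 1) f)) g"
    using mem' g unfolding hodge_laplacian_def
    by (simp add: faces.l2_add faces.emb_add inner_add_left flip: faces.inner_emb_emb)
  also have "l2_inner (faces K i) w (\<delta>\<^sub>a i (\<delta> i f)) g
      = l2_inner (faces K (i + 1)) w (\<delta> i f) (\<delta> i g)"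
    using inner_up_adjoint[OF g mem(1)] by (metis faces.l2_inner_commute upper.l2_inner_commute)
  also have "l2_inner (faces K i) w (\<delta> (i - 1) (\<delta>\<^sub>a (i - 1) f)) g
      = l2_inner (faces K (i - 1)) w (\<delta>\<^sub>a (i - 1) f) (\<delta>\<^sub>a (i - 1) g)"
    using inner_down_adjoint[OF mem(2) g] by simp
  finally show ?thesis .
qed

lemma laplacian_symmetric:
  "f \<in> l2 (faces K i) w \<Longrightarrow> g \<in> l2 (faces K i) w \<Longrightarrow>
    l2_inner (faces K i) w (L f) g = l2_inner (faces K i) w f (L g)"
  by (metis inner_laplacian faces.l2_inner_commute upper.l2_inner_commute lower.l2_inner_commute)

lemma coboundary_point:
  assumes "G \<in> faces K (j + 1)"
  shows "\<delta> j (point F) G = incidence_sign ori F G"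
proof -
  have "finite (face_boundary G)"
    by (rule finite_subset[of _ "Pow G"]) (auto simp: face_boundary_def finite_face[OF assms])
  then show ?thesis
    using assms incidence_sign_nonzero[of ori F G]
    by (auto simp: coboundary_def point_def if_distrib[of "(*) _"] sum.delta cong: if_cong)
qed

text \<open>Pairing with \<open>point E\<close> turns the abstractly described adjoint into a
  coboundary; the quotient w F / w E comes from the weights in the two inner products.\<close>

lemma coboundary_adjoint_point:
  assumes "F \<in> faces K i" "E \<in> faces K (i - 1)"
  shows "\<delta>\<^sub>a (i - 1) (point F) E = incidence_sign ori E F * w F / w E"
proof -
  have F: "point F \<in> l2 (faces K i) w" and E: "point E \<in> l2 (faces K (i - 1)) w"
    using assms by (auto intro: faces.point_in_l2 lower.point_in_l2)
  have "\<delta>\<^sub>a (i - 1) (point F) \<in> l2 (faces K (i - 1)) w" "\<delta> (i - 1) (point E) \<in> l2 (faces K i) w"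
    using E F down down_adjoint by (auto simp: l2_bounded_op_def)
  then have "\<delta>\<^sub>a (i - 1) (point F) E * w E = \<delta> (i - 1) (point E) F * w F"
    using inner_down_adjoint[OF E F] assms
    by (metis lower.l2_inner_point_left faces.l2_inner_point_left faces.l2_inner_commute)
  then show ?thesis
    using assms by (simp add: coboundary_point field_simps)
qed

text \<open>The entry is a sum over common cofaces plus a sum over common facets. Each has at most
  one nonzero term, and as signs have modulus at most 1 these are bounded by \<open>w_up\<close> and
  \<open>w_down\<close>.\<close>

lemma laplacian_entry_le:
  assumes F: "F \<in> faces K i" and F': "F' \<in> faces K i" and "F \<noteq> F'"
  shows "\<bar>l2_inner (faces K i) w (L (point F)) (point F')\<bar> \<le> face_weight K w i F F'"
proof -
  let ?\<sigma> = "incidence_sign ori"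
  have "l2_inner (faces K (i + 1)) w (\<delta> i (point F)) (\<delta> i (point F'))
      = (\<Sum>\<^sub>\<infinity>G\<in>faces K (i + 1). ?\<sigma> F G * ?\<sigma> F' G * w G)"
    unfolding l2_inner_def by (intro infsum_cong) (simp add: coboundary_point)
  also have "\<dots> = (if F \<union> F' \<in> faces K (i + 1)
      then ?\<sigma> F (F \<union> F') * ?\<sigma> F' (F \<union> F') * w (F \<union> F') else 0)"
  proof (rule infsum_single)
    fix G assume G: "G \<in> faces K (i + 1)" "?\<sigma> F G * ?\<sigma> F' G * w G \<noteq> 0"
    show "G = F \<union> F'"
      using G(2) incidence_sign_nonzero[of ori _ G] \<open>F \<noteq> F'\<close>
      by (intro union_of_boundary_faces finite_face[OF G(1)]) auto
  qed
  finally have up_eq: "l2_inner (faces K (i + 1)) w (\<delta> i (point F)) (\<delta> i (point F')) = \<dots>" .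
  have up_le: "\<bar>l2_inner (faces K (i + 1)) w (\<delta> i (point F)) (\<delta> i (point F'))\<bar> \<le> w_up K w i F F'"
  proof (cases "F \<union> F' \<in> faces K (i + 1) \<and> ?\<sigma> F (F \<union> F') * ?\<sigma> F' (F \<union> F') \<noteq> 0")
    case True
    then have "w_up K w i F F' = w (F \<union> F')"
      using incidence_sign_nonzero[of ori _ "F \<union> F'"] by (auto simp: w_up_def)
    then show ?thesis
      using True abs_sign_product_le[of ori F "F \<union> F'" F' "F \<union> F'" "w (F \<union> F')"]
      by (simp add: up_eq)
  next
    case False
    \<comment> \<open>If \<open>w_up\<close> takes the value of a weight, the witnessing coface must
      be the union of F and F', so that weight is positive.\<close>
    have "0 \<le> w_up K w i F F'"
      using union_of_boundary_faces[OF finite_face _ _ \<open>F \<noteq> F'\<close>]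
      by (auto simp: w_up_def)
    then show ?thesis using False by (auto simp: up_eq)
  qed
  have "l2_inner (faces K (i - 1)) w (\<delta>\<^sub>a (i - 1) (point F)) (\<delta>\<^sub>a (i - 1) (point F'))
      = (\<Sum>\<^sub>\<infinity>E\<in>faces K (i - 1). ?\<sigma> E F * ?\<sigma> E F' * (w F * w F' / w E))"
    unfolding l2_inner_def
    by (intro infsum_cong) (simp add: coboundary_adjoint_point F F' field_simps)
  also have "\<dots> = (if F \<inter> F' \<in> faces K (i - 1)
      then ?\<sigma> (F \<inter> F') F * ?\<sigma> (F \<inter> F') F' * (w F * w F' / w (F \<inter> F')) else 0)"
  proof (rule infsum_single)
    fix E assume E: "?\<sigma> E F * ?\<sigma> E F' * (w F * w F' / w E) \<noteq> 0"
    show "E = F \<inter> F'"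
      using E incidence_sign_nonzero[of ori E] \<open>F \<noteq> F'\<close>
      by (intro intersection_of_cofaces finite_face[OF F] finite_face[OF F']) auto
  qed
  finally have down_eq:
    "l2_inner (faces K (i - 1)) w (\<delta>\<^sub>a (i - 1) (point F)) (\<delta>\<^sub>a (i - 1) (point F')) = \<dots>" .
  have "\<bar>l2_inner (faces K (i - 1)) w (\<delta>\<^sub>a (i - 1) (point F)) (\<delta>\<^sub>a (i - 1) (point F'))\<bar>
      \<le> w_down K w i F F'"
  proof (cases "F \<inter> F' \<in> faces K (i - 1)")
    case True
    then have "0 \<le> w F * w F' / w (F \<inter> F')" using F F' by simp
    then show ?thesis
      using True abs_sign_product_le[of ori "F \<inter> F'" F "F \<inter> F'" F' "w F * w F' / w (F \<inter> F')"]
      by (simp add: down_eq w_down_def)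
  qed (simp add: down_eq w_down_def)
  with up_le show ?thesis
    using F F' \<open>F \<noteq> F'\<close>
    by (simp add: inner_laplacian faces.point_in_l2 face_weight_def)
qed

lemma heat_semigroup_bound:
  assumes \<rho>: "intrinsic_metric K w i \<rho>"
    and s: "0 < s" "jump_size K w i \<rho> = ennreal s"
    and AB: "A \<subseteq> faces K i" "B \<subseteq> faces K i"
    and f: "f \<in> l2 (faces K i) w" "support_on (faces K i) f \<subseteq> A"
    and g: "g \<in> l2 (faces K i) w" "support_on (faces K i) g \<subseteq> B"
    and t: "0 < t"
  shows "\<bar>l2_inner (faces K i) w (heat_semigroup K w ori i t f) g\<bar>
    \<le> exp_ereal (ereal (- l2_spectrum_bottom (faces K i) w L * t) - zeta_fun s t (set_distance \<rho> A B))
      * l2_norm (faces K i) w f * l2_norm (faces K i) w g"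
  unfolding heat_semigroup_def
proof (rule faces.l2_exp_davies_gaffney[OF laplacian_bounded_op laplacian_symmetric
      laplacian_entry_le _ _ _ s(1) t AB f g])
  show "pseudo_metric_on (faces K i) \<rho>"
    using \<rho> by (simp add: intrinsic_metric_def)
  show "(\<Sum>\<^sub>\<infinity>F'\<in>faces K i. ennreal (face_weight K w i F F') * (\<rho> F F')\<^sup>2) \<le> ennreal (w F)"
    if "F \<in> faces K i" for F
    using \<rho> that by (simp add: intrinsic_metric_def)
  show "\<rho> F F' \<le> ennreal s"
    if F: "F \<in> faces K i" "F' \<in> faces K i" "face_weight K w i F F' \<noteq> 0" for F F'
  proof -
    \<comment> \<open>The given pair shows that N is nonempty, so \<open>jump_size\<close> is the
      supremum and not the default infinity.\<close>
    define N where "N = {(F, F'). F \<in> faces K i \<and> F' \<in> faces K i \<and> face_weight K w i F F' \<noteq> 0}"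
    have N: "(F, F') \<in> N" using F by (simp add: N_def)
    then have "jump_size K w i \<rho> = (SUP (F, F')\<in>N. \<rho> F F')"
      unfolding jump_size_def N_def[symmetric] Let_def by auto
    then show ?thesis
      using SUP_upper[OF N, of "\<lambda>(F, F'). \<rho> F F'"] s(2) by simp
  qed
qed

lemma heat_semigroup_in_l2:
  assumes "f \<in> l2 (faces K i) w"
  shows "heat_semigroup K w ori i t f \<in> l2 (faces K i) w"
  unfolding heat_semigroup_def
  by (rule faces.l2_exp_in_l2[OF faces.represents_scale[OF
        faces.represents_extension[OF laplacian_bounded_op]] assms])

lemma heat_semigroup_symmetric:
  assumes "f \<in> l2 (faces K i) w" "g \<in> l2 (faces K i) w"
  shows "l2_inner (faces K i) w (heat_semigroup K w ori i t f) g
    = l2_inner (faces K i) w f (heat_semigroup K w ori i t g)"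
  unfolding heat_semigroup_def
  by (rule faces.l2_exp_symmetric[OF laplacian_bounded_op laplacian_symmetric assms])

end

section \<open>Heat kernel sums as pairings with indicators\<close>

context weighted_set
begin

lemma l2_product_summable:
  assumes "f \<in> l2 X w" "g \<in> l2 X w"
  shows "(\<lambda>x. f x * g x * w x) summable_on X"
proof -
  have "(\<lambda>x. Rep_ell2 (emb f) x * Rep_ell2 (emb g) x) summable_on UNIV"
    by (intro square_summable_mult ell2_square_summable)
  then have "(\<lambda>x. Rep_ell2 (emb f) x * Rep_ell2 (emb g) x) summable_on X"
    by (rule summable_on_subset) auto
  also have "?this \<longleftrightarrow> ?thesis"
    by (rule summable_on_cong) (simp add: Rep_emb assms ac_simps)
  finally show ?thesis .
qed

lemma
  assumes A: "A \<subseteq> X" "w summable_on A"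
  shows indicator_in_l2: "indicator A \<in> l2 X w"
    and l2_norm_indicator: "l2_norm X w (indicator A) = sqrt (infsum w A)"
    and l2_inner_indicator: "l2_inner X w f (indicator A) = (\<Sum>\<^sub>\<infinity>x\<in>A. f x * w x)"
proof -
  have "(\<lambda>x. (indicator A x)\<^sup>2 * w x) summable_on X \<longleftrightarrow> w summable_on A"
    using A by (intro summable_on_cong_neutral) (auto simp: indicator_def)
  then show "indicator A \<in> l2 X w"
    using A by (auto simp: l2_def indicator_def)
  show "l2_norm X w (indicator A) = sqrt (infsum w A)"
    unfolding l2_norm_def l2_inner_def
    using A by (intro arg_cong[where f = sqrt] infsum_cong_neutral) (auto simp: indicator_def)
  show "l2_inner X w f (indicator A) = (\<Sum>\<^sub>\<infinity>x\<in>A. f x * w x)"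
    unfolding l2_inner_def using A by (intro infsum_cong_neutral) (auto simp: indicator_def)
qed

lemma l2_summable_on_subset:
  assumes A: "A \<subseteq> X" "w summable_on A" and f: "f \<in> l2 X w"
  shows "(\<lambda>x. f x * w x) summable_on A"
proof -
  have "(\<lambda>x. f x * indicator A x * w x) summable_on X"
    by (intro l2_product_summable f indicator_in_l2 A)
  also have "?this \<longleftrightarrow> ?thesis"
    using A by (intro summable_on_cong_neutral) (auto simp: indicator_def)
  finally show ?thesis .
qed

end

text \<open>Summing the kernel over A is pairing the evolved point mass at F' with the indicator of
  A. Symmetry moves the semigroup onto the indicator, and the point mass then evaluates the result
  at F'.\<close>

lemma (in bounded_hodge) heat_kernel_sums:
  assumes A: "A \<subseteq> faces K i" "w summable_on A" and F': "F' \<in> faces K i"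
  shows heat_kernel_summable:
      "(\<lambda>F. heat_kernel K w ori i t F F' * w F * w F') summable_on A"
    and infsum_heat_kernel:
      "(\<Sum>\<^sub>\<infinity>F\<in>A. heat_kernel K w ori i t F F' * w F * w F')
        = heat_semigroup K w ori i t (indicator A) F' * w F'"
proof -
  \<comment> \<open>The initial datum of the kernel; in a pairing its factor 1 / w F' cancels the
    weight, so it acts as evaluation at F'.\<close>
  define p where "p = (\<lambda>G. (1 / w F') * point F' G)"
  define h where "h = heat_semigroup K w ori i t p"
  have p: "p \<in> l2 (faces K i) w"
    unfolding p_def using F' by (intro faces.l2_scale faces.point_in_l2)
  then have h: "h \<in> l2 (faces K i) w"
    unfolding h_def by (rule heat_semigroup_in_l2)
  have kernel: "heat_kernel K w ori i t F F' = h F" for F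
    unfolding heat_kernel_def h_def p_def point_def
    by (rule arg_cong[where f = "\<lambda>q. heat_semigroup K w ori i t q F"]) auto
  show "(\<lambda>F. heat_kernel K w ori i t F F' * w F * w F') summable_on A"
    unfolding kernel by (intro summable_on_cmult_left faces.l2_summable_on_subset A h)
  let ?H = "heat_semigroup K w ori i t (indicator A)"
  have H: "?H \<in> l2 (faces K i) w"
    by (intro heat_semigroup_in_l2 faces.indicator_in_l2 A)
  have "(\<Sum>\<^sub>\<infinity>F\<in>A. h F * w F) = l2_inner (faces K i) w h (indicator A)"
    by (rule faces.l2_inner_indicator[OF A, symmetric])
  also have "\<dots> = l2_inner (faces K i) w p ?H"
    unfolding h_def by (intro heat_semigroup_symmetric p faces.indicator_in_l2 A)
  also have "\<dots> = ?H F'"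
    using faces.l2_inner_scale[of "1 / w F'" "point F'" 1 ?H] F' H
    by (simp add: p_def faces.l2_inner_point_left)
  finally show "(\<Sum>\<^sub>\<infinity>F\<in>A. heat_kernel K w ori i t F F' * w F * w F') = ?H F' * w F'"
    unfolding kernel by (simp add: infsum_cmult_left')
qed

theorem theorem1p2:
  fixes V :: "'v set" and K :: "'v set set" and w :: "'v set \<Rightarrow> real"
    and ori :: "'v set \<Rightarrow> 'v list set" and i :: int
    and \<rho> :: "'v set \<Rightarrow> 'v set \<Rightarrow> ennreal" and s lam :: real
    and A B :: "'v set set"
  assumes "abstract_simplicial_complex V K" and "weighted_complex K w" and "oriented_complex K ori"
    and "0 \<le> i" and "ereal (of_int i) \<le> complex_dim K"
    and "hodge_laplacian_bounded K w ori i"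
    and "intrinsic_metric K w i \<rho>"
    and "0 < s" and "jump_size K w i \<rho> = ennreal s"
    and "lam = l2_spectrum_bottom (faces K i) w (hodge_laplacian K w ori i)"
    and "A \<subseteq> faces K i" and "B \<subseteq> faces K i"
  shows "(\<forall>f\<in>l2 (faces K i) w. \<forall>g\<in>l2 (faces K i) w.
            support_on (faces K i) f \<subseteq> A \<longrightarrow> support_on (faces K i) g \<subseteq> B \<longrightarrow>
            (\<forall>t>0. \<bar>l2_inner (faces K i) w (heat_semigroup K w ori i t f) g\<bar>
                    \<le> exp_ereal (ereal (- lam * t) - zeta_fun s t (set_distance \<rho> A B))
                       * l2_norm (faces K i) w f * l2_norm (faces K i) w g))
       \<and> (w summable_on A \<and> w summable_on B \<longrightarrow>
            (\<forall>t>0. (\<forall>F'\<in>B. (\<lambda>F. heat_kernel K w ori i t F F' * w F * w F') summable_on A)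
                  \<and> (\<lambda>F'. \<Sum>\<^sub>\<infinity>F\<in>A. heat_kernel K w ori i t F F' * w F * w F') summable_on B
                  \<and> \<bar>\<Sum>\<^sub>\<infinity>F'\<in>B. \<Sum>\<^sub>\<infinity>F\<in>A. heat_kernel K w ori i t F F' * w F * w F'\<bar>
                    \<le> sqrt (infsum w A * infsum w B)
                       * exp_ereal (ereal (- lam * t) - zeta_fun s t (set_distance \<rho> A B))))"
proof -
  interpret bounded_hodge V K w ori i
    using assms by unfold_locales
  note A = \<open>A \<subseteq> faces K i\<close> and B = \<open>B \<subseteq> faces K i\<close>
  note bound = heat_semigroup_bound[OF \<open>intrinsic_metric K w i \<rho>\<close> \<open>0 < s\<close>
      \<open>jump_size K w i \<rho> = ennreal s\<close> A B, folded \<open>lam = _\<close>]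
  show ?thesis
  proof (intro conjI impI ballI allI)
    fix t :: real
    assume fin: "w summable_on A \<and> w summable_on B" and "0 < t"
    then have wA: "w summable_on A" and wB: "w summable_on B" by auto
    let ?H = "heat_semigroup K w ori i t (indicator A)"
    have H: "?H \<in> l2 (faces K i) w"
      by (intro heat_semigroup_in_l2 faces.indicator_in_l2 A wA)
    have inner_sum: "(\<Sum>\<^sub>\<infinity>F\<in>A. heat_kernel K w ori i t F F' * w F * w F') = ?H F' * w F'"
      if "F' \<in> B" for F'
      using that B by (intro infsum_heat_kernel A wA) auto
    show "(\<lambda>F. heat_kernel K w ori i t F F' * w F * w F') summable_on A" if "F' \<in> B" for F'
      using that B by (intro heat_kernel_summable A wA) auto
    \<comment> \<open>With the inner sums evaluated, the outer sum is a pairing of \<open>?H\<close>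
      with the indicator of B, so it converges as a product of two square summable functions and the
      first estimate applies.\<close>
    have "(\<lambda>F'. ?H F' * w F') summable_on B"
      by (intro faces.l2_summable_on_subset B wB H)
    then show "(\<lambda>F'. \<Sum>\<^sub>\<infinity>F\<in>A. heat_kernel K w ori i t F F' * w F * w F') summable_on B"
      by (simp only: inner_sum cong: summable_on_cong)
    have "(\<Sum>\<^sub>\<infinity>F'\<in>B. \<Sum>\<^sub>\<infinity>F\<in>A. heat_kernel K w ori i t F F' * w F * w F')
        = l2_inner (faces K i) w ?H (indicator B)"
      by (simp only: inner_sum faces.l2_inner_indicator[OF B wB] cong: infsum_cong)
    then show "\<bar>\<Sum>\<^sub>\<infinity>F'\<in>B. \<Sum>\<^sub>\<infinity>F\<in>A. heat_kernel K w ori i t F F' * w F * w F'\<bar>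
        \<le> sqrt (infsum w A * infsum w B)
          * exp_ereal (ereal (- lam * t) - zeta_fun s t (set_distance \<rho> A B))"
      using bound[OF faces.indicator_in_l2[OF A wA] _ faces.indicator_in_l2[OF B wB] _ \<open>0 < t\<close>]
      by (simp add: faces.l2_norm_indicator[OF A wA] faces.l2_norm_indicator[OF B wB] real_sqrt_mult support_on_def indicator_def
          subset_iff ac_simps)
  qed (rule bound)
qed

end
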